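(* (F. & M. Riesz type theorem) Suppose that a weak* closed subalgebra $A$ of a von Neumann algebra $M$ is an Ueda algebra in $M$. If $\varphi \in M^*$ annihilates $A$ (that is, $\varphi \in A^\perp$), then the normal and singular parts $\varphi_n$ and $\varphi_s$ of $\varphi$ also annihilate $A$.
   Context: $M^{**}$ is regarded as a von Neumann algebra with predual $M^*$. There is a central projection $z_n\in M^{**}$ with $M_* = \{\varphi \in M^* : \varphi = \varphi(z_n\,\cdot\,)\}$ ($M_*$ being the set of normal functionals on $M$). For $\varphi\in M^*$ its normal part is $\varphi_n = \varphi(z_n\,\cdot\,)$ and its singular part is $\varphi_s = \varphi((1-z_n)\,\cdot\,)$; $\varphi$ is singular if $\varphi=\varphi_s$. The projection $1-z_n$ is the singular part projection of $M^{**}$. A peak projection for a closed subalgebra $A \subseteq M$ is a projection $q \in M^{**}$ which is the weak* limit in $M^{**}$ of $(a^n)_{n}$ for some $a \in A$ with $\|a\|\le 1$. A weak* closed subalgebra $A$ of $M$ is an Ueda algebra in $M$ if for every singular state $\varphi$ on $M$ there is a peak projection $q$ for $A$ with $\varphi(q)=1$ and $q \le 1-z_n$. *)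

theory Defs
  imports "HOL-Analysis.Analysis"
begin

section \<open>Complex Banach spaces and unital C*-algebras\<close>

class complex_normed_vector = real_normed_vector +
  fixes scaleC :: "complex \<Rightarrow> 'a \<Rightarrow> 'a"  (infixr "*\<^sub>C" 75)
  assumes scaleC_add_right: "c *\<^sub>C (x + y) = c *\<^sub>C x + c *\<^sub>C y"
    and scaleC_add_left: "(c + d) *\<^sub>C x = c *\<^sub>C x + d *\<^sub>C x"
    and scaleC_scaleC: "c *\<^sub>C d *\<^sub>C x = (c * d) *\<^sub>C x"
    and scaleR_scaleC: "r *\<^sub>R x = complex_of_real r *\<^sub>C x"
    and norm_scaleC: "norm (c *\<^sub>C x) = norm c * norm x"

class complex_banach = complex_normed_vector + complete_space

class cstar_algebra = complex_banach + real_normed_algebra_1 +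
  fixes adj :: "'a \<Rightarrow> 'a"
  assumes scaleC_mult_left: "(c *\<^sub>C x) * y = c *\<^sub>C (x * y)"
    and scaleC_mult_right: "x * (c *\<^sub>C y) = c *\<^sub>C (x * y)"
    and adj_add: "adj (x + y) = adj x + adj y"
    and adj_scaleC: "adj (c *\<^sub>C x) = cnj c *\<^sub>C adj x"
    and adj_mult: "adj (x * y) = adj y * adj x"
    and adj_adj: "adj (adj x) = x"
    and cstar_identity: "norm (adj x * x) = (norm x)\<^sup>2"

lemma scaleC_zero_right: "c *\<^sub>C (0::'a::complex_normed_vector) = 0"
  using norm_scaleC[of c "0::'a"] by simp

lemma norm_adj:
  fixes x :: "'a::cstar_algebra"
  shows "norm (adj x) = norm x"
proof -
  have le: "norm y \<le> norm (adj y)" for y :: 'a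
  proof (cases "y = 0")
    case False
    have "norm y * norm y \<le> norm (adj y) * norm y"
      using norm_mult_ineq[of "adj y" y] by (simp add: cstar_identity power2_eq_square)
    then show ?thesis using False by simp
  qed simp
  show ?thesis using le[of x] le[of "adj x"] by (simp add: adj_adj)
qed


section \<open>The Banach dual\<close>

typedef (overloaded) 'a cdual =
  "{f :: 'a::complex_normed_vector \<Rightarrow> complex. bounded_linear f \<and> (\<forall>c x. f (c *\<^sub>C x) = c * f x)}"
  morphisms dual_apply Dual
  by (rule exI[of _ "\<lambda>_. 0"]) (simp add: bounded_linear_zero)

lemma dual_eqI: "(\<And>x. dual_apply f x = dual_apply g x) \<Longrightarrow> f = g"
  by (metis dual_apply_inject ext)

lemma bounded_linear_dual_apply: "bounded_linear (dual_apply f)"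
  using dual_apply[of f] by simp

lemma dual_apply_add: "dual_apply f (x + y) = dual_apply f x + dual_apply f y"
  by (rule linear_add[OF bounded_linear.linear[OF bounded_linear_dual_apply]])

lemma dual_apply_scaleC: "dual_apply f (c *\<^sub>C x) = c * dual_apply f x"
  using dual_apply[of f] by simp

lemma dual_apply_Dual:
  assumes "\<And>x y. f (x + y) = f x + f y" "\<And>c x. f (c *\<^sub>C x) = c * f x"
    "\<And>x. norm (f x) \<le> norm x * K"
  shows "dual_apply (Dual f) = f"
proof (rule Dual_inverse, simp add: assms(2), rule bounded_linear_intro)
  show "f (r *\<^sub>R x) = r *\<^sub>R f x" for r x
    by (simp add: scaleR_scaleC assms(2) scaleR_conv_of_real)
qed (use assms in auto)

instantiation cdual :: (complex_normed_vector) complex_normed_vector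
begin

definition zero_cdual :: "'a cdual" where "0 = Dual (\<lambda>_. 0)"
definition plus_cdual :: "'a cdual \<Rightarrow> 'a cdual \<Rightarrow> 'a cdual"
  where "f + g = Dual (\<lambda>x. dual_apply f x + dual_apply g x)"
definition minus_cdual :: "'a cdual \<Rightarrow> 'a cdual \<Rightarrow> 'a cdual"
  where "f - g = Dual (\<lambda>x. dual_apply f x - dual_apply g x)"
definition uminus_cdual :: "'a cdual \<Rightarrow> 'a cdual"
  where "- f = Dual (\<lambda>x. - dual_apply f x)"
definition scaleC_cdual :: "complex \<Rightarrow> 'a cdual \<Rightarrow> 'a cdual"
  where "c *\<^sub>C f = Dual (\<lambda>x. c * dual_apply f x)"
definition scaleR_cdual :: "real \<Rightarrow> 'a cdual \<Rightarrow> 'a cdual"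
  where "r *\<^sub>R f = complex_of_real r *\<^sub>C (f :: 'a cdual)"
definition norm_cdual :: "'a cdual \<Rightarrow> real"
  where "norm f = onorm (dual_apply f)"
definition dist_cdual :: "'a cdual \<Rightarrow> 'a cdual \<Rightarrow> real"
  where "dist_cdual f g = norm (f - g)"
definition sgn_cdual :: "'a cdual \<Rightarrow> 'a cdual"
  where "sgn_cdual f = inverse (norm f) *\<^sub>R f"
definition uniformity_cdual :: "('a cdual \<times> 'a cdual) filter"
  where "uniformity_cdual = (INF e\<in>{0 <..}. principal {(x :: 'a cdual, y). dist x y < e})"
definition open_cdual :: "'a cdual set \<Rightarrow> bool"
  where "open_cdual S = (\<forall>x\<in>S. \<forall>\<^sub>F (x', y) in uniformity. x' = x \<longrightarrow> y \<in> S)"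

lemma dual_apply_zero_fun [simp]: "dual_apply 0 = (\<lambda>_::'a. 0)"
  unfolding zero_cdual_def by (rule dual_apply_Dual[where K = 0]) auto

lemma dual_apply_plus_fun [simp]: "dual_apply (f + g) = (\<lambda>x::'a. dual_apply f x + dual_apply g x)"
  unfolding plus_cdual_def
  by (rule Dual_inverse)
    (auto simp: dual_apply_scaleC distrib_left intro!: bounded_linear_add bounded_linear_dual_apply)

lemma dual_apply_minus_fun [simp]: "dual_apply (f - g) = (\<lambda>x::'a. dual_apply f x - dual_apply g x)"
  unfolding minus_cdual_def
  by (rule Dual_inverse)
    (auto simp: dual_apply_scaleC right_diff_distrib intro!: bounded_linear_sub bounded_linear_dual_apply)

lemma dual_apply_uminus_fun [simp]: "dual_apply (- f) = (\<lambda>x::'a. - dual_apply f x)"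
  unfolding uminus_cdual_def
  by (rule Dual_inverse)
    (auto simp: dual_apply_scaleC intro!: bounded_linear_minus bounded_linear_dual_apply)

lemma dual_apply_scaleC_fun [simp]: "dual_apply (c *\<^sub>C f) = (\<lambda>x::'a. c * dual_apply f x)"
  unfolding scaleC_cdual_def
  by (rule Dual_inverse)
    (auto simp: dual_apply_scaleC intro!: bounded_linear_const_mult bounded_linear_dual_apply)

instance
proof
  fix f g h :: "'a cdual" and c d :: complex and r s :: real
  show "f + g + h = f + (g + h)" "f + g = g + f" "0 + f = f" "- f + f = 0" "f - g = f + - g"
    by (auto intro!: dual_eqI)
  show "r *\<^sub>R (f + g) = r *\<^sub>R f + r *\<^sub>R g" "(r + s) *\<^sub>R f = r *\<^sub>R f + s *\<^sub>R f"
    "r *\<^sub>R s *\<^sub>R f = (r * s) *\<^sub>R f" "1 *\<^sub>R f = f"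
    by (auto intro!: dual_eqI simp: scaleR_cdual_def algebra_simps)
  show "c *\<^sub>C (f + g) = c *\<^sub>C f + c *\<^sub>C g" "(c + d) *\<^sub>C f = c *\<^sub>C f + d *\<^sub>C f"
    "c *\<^sub>C d *\<^sub>C f = (c * d) *\<^sub>C f" "r *\<^sub>R f = complex_of_real r *\<^sub>C f"
    by (auto intro!: dual_eqI simp: scaleR_cdual_def algebra_simps)
  show "norm (f + g) \<le> norm f + norm g"
    by (auto simp: norm_cdual_def intro!: onorm_triangle bounded_linear_dual_apply)
  have le: "norm (c *\<^sub>C f) \<le> norm c * norm f" for c and f :: "'a cdual"
    unfolding norm_cdual_def
  proof (rule onorm_bound)
    show "0 \<le> norm c * onorm (dual_apply f)"
      by (simp add: onorm_pos_le bounded_linear_dual_apply)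
    show "norm (dual_apply (c *\<^sub>C f) x) \<le> norm c * onorm (dual_apply f) * norm x" for x
      using onorm[OF bounded_linear_dual_apply, of f x]
      by (simp add: norm_mult mult.assoc mult_left_mono)
  qed
  show nC: "norm (c *\<^sub>C f) = norm c * norm f" for c and f :: "'a cdual"
  proof (cases "c = 0")
    case True
    have "norm (0 :: 'a cdual) = 0" by (simp add: norm_cdual_def onorm_zero)
    moreover have "0 *\<^sub>C f = 0" by (auto intro!: dual_eqI)
    ultimately show ?thesis using True by simp
  next
    case False
    have "f = inverse c *\<^sub>C c *\<^sub>C f" using False by (auto intro!: dual_eqI)
    then have "norm f \<le> norm (inverse c) * norm (c *\<^sub>C f)" by (metis le)
    then have "norm c * norm f \<le> norm (c *\<^sub>C f)"
      using False by (simp add: norm_inverse norm_divide field_simps)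
    with le[of c f] show ?thesis by simp
  qed
  show "norm (r *\<^sub>R f) = \<bar>r\<bar> * norm f" by (simp add: scaleR_cdual_def nC)
  show "norm f = 0 \<longleftrightarrow> f = 0"
    by (auto simp: norm_cdual_def onorm_eq_0 bounded_linear_dual_apply intro!: dual_eqI)
qed (rule dist_cdual_def sgn_cdual_def uniformity_cdual_def open_cdual_def)+

end

lemma norm_dual_apply: "norm (dual_apply f x) \<le> norm f * norm x"
  unfolding norm_cdual_def by (rule onorm[OF bounded_linear_dual_apply])

definition weak_star_topology :: "'a::complex_normed_vector cdual topology" where
  "weak_star_topology =
     pullback_topology UNIV dual_apply (product_topology (\<lambda>_. euclidean) UNIV)"


section \<open>The bidual of a C*-algebra\<close>

type_synonym 'a bidual = "'a cdual cdual"

definition canonical :: "'a::complex_normed_vector \<Rightarrow> 'a bidual" where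
  "canonical x = Dual (\<lambda>\<phi>. dual_apply \<phi> x)"

text \<open>
  The first Arens product, built from the module actions
  \<open>(\<phi> \<cdot> x)(y) = \<phi>(x y)\<close> and \<open>(G \<cdot> \<phi>)(x) = G(\<phi> \<cdot> x)\<close> for
  \<open>x, y \<in> M\<close>, \<open>\<phi> \<in> M\<^sup>*\<close>, \<open>G \<in> M\<^sup>*\<^sup>*\<close>.
  A C*-algebra is Arens regular, so this is the multiplication of the von Neumann algebra
  \<open>M\<^sup>*\<^sup>*\<close>, that is, the separately weak* continuous extension of the product of \<open>M\<close>.
\<close>

definition dual_times :: "'a::cstar_algebra cdual \<Rightarrow> 'a \<Rightarrow> 'a cdual" where
  "dual_times \<phi> x = Dual (\<lambda>y. dual_apply \<phi> (x * y))"

definition bidual_act :: "'a::cstar_algebra bidual \<Rightarrow> 'a cdual \<Rightarrow> 'a cdual" where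
  "bidual_act G \<phi> = Dual (\<lambda>x. dual_apply G (dual_times \<phi> x))"

definition arens :: "'a::cstar_algebra bidual \<Rightarrow> 'a bidual \<Rightarrow> 'a bidual"  (infixl "\<odot>" 70) where
  "F \<odot> G = Dual (\<lambda>\<phi>. dual_apply F (bidual_act G \<phi>))"

definition dual_adj :: "'a::cstar_algebra cdual \<Rightarrow> 'a cdual" where
  "dual_adj \<phi> = Dual (\<lambda>x. cnj (dual_apply \<phi> (adj x)))"

definition bidual_adj :: "'a::cstar_algebra bidual \<Rightarrow> 'a bidual" where
  "bidual_adj F = Dual (\<lambda>\<phi>. cnj (dual_apply F (dual_adj \<phi>)))"

text \<open>
  \<^const>\<open>Dual\<close> is unspecified outside the bounded functionals; the next lemmas show that
  the definitions above take the intended values.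
\<close>

lemma norm_dual_le:
  assumes "\<And>x. norm (dual_apply f x) \<le> K * norm x" "0 \<le> K"
  shows "norm f \<le> K"
  unfolding norm_cdual_def using assms by (auto intro: onorm_bound)

lemma canonical_apply [simp]: "dual_apply (canonical x) \<phi> = dual_apply \<phi> x"
proof -
  have "dual_apply (canonical x) = (\<lambda>\<phi>. dual_apply \<phi> x)"
    unfolding canonical_def
    by (rule dual_apply_Dual[where K = "norm x"]) (auto simp: norm_dual_apply)
  then show ?thesis by simp
qed

lemma dual_times_apply [simp]: "dual_apply (dual_times \<phi> x) y = dual_apply \<phi> (x * y)"
proof -
  have "norm (dual_apply \<phi> (x * y)) \<le> norm y * (norm \<phi> * norm x)" for y
    using order_trans[OF norm_dual_apply[of \<phi> "x * y"]
        mult_left_mono[OF norm_mult_ineq[of x y] norm_ge_zero[of \<phi>]]]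
    by (simp add: ac_simps)
  then have "dual_apply (dual_times \<phi> x) = (\<lambda>y. dual_apply \<phi> (x * y))"
    unfolding dual_times_def
    by (intro dual_apply_Dual) (auto simp: distrib_left dual_apply_add scaleC_mult_right dual_apply_scaleC)
  then show ?thesis by simp
qed

lemma norm_dual_times: "norm (dual_times \<phi> x) \<le> norm \<phi> * norm x"
proof (rule norm_dual_le)
  show "norm (dual_apply (dual_times \<phi> x) y) \<le> norm \<phi> * norm x * norm y" for y
    using order_trans[OF norm_dual_apply[of \<phi> "x * y"]
        mult_left_mono[OF norm_mult_ineq[of x y] norm_ge_zero[of \<phi>]]]
    by (simp add: ac_simps)
qed simp

lemma bidual_act_apply [simp]:
  "dual_apply (bidual_act G \<phi>) x = dual_apply G (dual_times \<phi> x)"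
proof -
  have 1: "dual_times \<phi> (x + y) = dual_times \<phi> x + dual_times \<phi> y" for x y
    by (auto intro!: dual_eqI simp: distrib_right dual_apply_add)
  have 2: "dual_times \<phi> (c *\<^sub>C x) = c *\<^sub>C dual_times \<phi> x" for c x
    by (auto intro!: dual_eqI simp: scaleC_mult_left dual_apply_scaleC)
  have "norm (dual_apply G (dual_times \<phi> x)) \<le> norm x * (norm G * norm \<phi>)" for x
    using order_trans[OF norm_dual_apply[of G "dual_times \<phi> x"]
        mult_left_mono[OF norm_dual_times[of \<phi> x] norm_ge_zero[of G]]]
    by (simp add: ac_simps)
  then have "dual_apply (bidual_act G \<phi>) = (\<lambda>x. dual_apply G (dual_times \<phi> x))"
    unfolding bidual_act_def
    by (intro dual_apply_Dual) (auto simp: 1 2 dual_apply_add dual_apply_scaleC simp del: dual_apply_plus_fun dual_apply_scaleC_fun)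
  then show ?thesis by simp
qed

lemma norm_bidual_act: "norm (bidual_act G \<phi>) \<le> norm G * norm \<phi>"
proof (rule norm_dual_le)
  show "norm (dual_apply (bidual_act G \<phi>) x) \<le> norm G * norm \<phi> * norm x" for x
    using order_trans[OF norm_dual_apply[of G "dual_times \<phi> x"]
        mult_left_mono[OF norm_dual_times[of \<phi> x] norm_ge_zero[of G]]]
    by (simp add: ac_simps)
qed simp

lemma arens_apply [simp]: "dual_apply (F \<odot> G) \<phi> = dual_apply F (bidual_act G \<phi>)"
proof -
  have a: "dual_times (\<phi> + \<psi>) x = dual_times \<phi> x + dual_times \<psi> x" for \<phi> \<psi> :: "'a cdual" and x
    by (auto intro!: dual_eqI)
  have b: "dual_times (c *\<^sub>C \<phi>) x = c *\<^sub>C dual_times \<phi> x" for c and \<phi> :: "'a cdual" and x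
    by (auto intro!: dual_eqI)
  have 1: "bidual_act G (\<phi> + \<psi>) = bidual_act G \<phi> + bidual_act G \<psi>" for \<phi> \<psi>
    by (rule dual_eqI) (simp add: a dual_apply_add)
  have 2: "bidual_act G (c *\<^sub>C \<phi>) = c *\<^sub>C bidual_act G \<phi>" for c \<phi>
    by (rule dual_eqI) (simp add: b dual_apply_scaleC)
  have "norm (dual_apply F (bidual_act G \<phi>)) \<le> norm \<phi> * (norm F * norm G)" for \<phi>
    using order_trans[OF norm_dual_apply[of F "bidual_act G \<phi>"]
        mult_left_mono[OF norm_bidual_act[of G \<phi>] norm_ge_zero[of F]]]
    by (simp add: ac_simps)
  then have "dual_apply (F \<odot> G) = (\<lambda>\<phi>. dual_apply F (bidual_act G \<phi>))"
    unfolding arens_def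
    by (intro dual_apply_Dual) (auto simp: 1 2 dual_apply_add dual_apply_scaleC)
  then show ?thesis by simp
qed

lemma dual_adj_apply [simp]: "dual_apply (dual_adj \<phi>) x = cnj (dual_apply \<phi> (adj x))"
proof -
  have "norm (cnj (dual_apply \<phi> (adj x))) \<le> norm x * norm \<phi>" for x
    using norm_dual_apply[of \<phi> "adj x"] by (simp add: norm_adj mult.commute)
  then have "dual_apply (dual_adj \<phi>) = (\<lambda>x. cnj (dual_apply \<phi> (adj x)))"
    unfolding dual_adj_def
    by (intro dual_apply_Dual) (auto simp: adj_add adj_scaleC dual_apply_add dual_apply_scaleC)
  then show ?thesis by simp
qed

lemma norm_dual_adj: "norm (dual_adj \<phi>) \<le> norm \<phi>"
proof (rule norm_dual_le)
  show "norm (dual_apply (dual_adj \<phi>) x) \<le> norm \<phi> * norm x" for x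
    using norm_dual_apply[of \<phi> "adj x"] by (simp add: norm_adj)
qed simp

lemma bidual_adj_apply [simp]: "dual_apply (bidual_adj F) \<phi> = cnj (dual_apply F (dual_adj \<phi>))"
proof -
  have 1: "dual_adj (\<phi> + \<psi>) = dual_adj \<phi> + dual_adj \<psi>" for \<phi> \<psi> :: "'a cdual"
    by (auto intro!: dual_eqI)
  have 2: "dual_adj (c *\<^sub>C \<phi>) = cnj c *\<^sub>C dual_adj \<phi>" for c and \<phi> :: "'a cdual"
    by (auto intro!: dual_eqI)
  have "norm (cnj (dual_apply F (dual_adj \<phi>))) \<le> norm \<phi> * norm F" for \<phi>
    using order_trans[OF norm_dual_apply[of F "dual_adj \<phi>"]
        mult_left_mono[OF norm_dual_adj[of \<phi>] norm_ge_zero[of F]]]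
    by (simp add: mult.commute)
  then have "dual_apply (bidual_adj F) = (\<lambda>\<phi>. cnj (dual_apply F (dual_adj \<phi>)))"
    unfolding bidual_adj_def
    by (intro dual_apply_Dual) (auto simp: 1 2 dual_apply_add dual_apply_scaleC)
  then show ?thesis by simp
qed

lemma canonical_mult: "canonical (x * y) = canonical x \<odot> canonical y"
  by (rule dual_eqI) simp

lemma canonical_adj: "canonical (adj x) = bidual_adj (canonical x)"
  by (rule dual_eqI) (simp add: adj_adj)

lemma canonical_one_left: "canonical 1 \<odot> F = (F :: 'a::cstar_algebra bidual)"
proof (rule dual_eqI)
  fix \<phi> :: "'a cdual"
  have "dual_times \<phi> 1 = \<phi>" by (rule dual_eqI) simp
  then show "dual_apply (canonical 1 \<odot> F) \<phi> = dual_apply F \<phi>" by simp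
qed

lemma canonical_one_right: "F \<odot> canonical 1 = (F :: 'a::cstar_algebra bidual)"
proof (rule dual_eqI)
  fix \<phi> :: "'a cdual"
  have "bidual_act (canonical 1) \<phi> = \<phi>" by (rule dual_eqI) simp
  then show "dual_apply (F \<odot> canonical 1) \<phi> = dual_apply F \<phi>" by simp
qed

definition bidual_projection :: "'a::cstar_algebra bidual \<Rightarrow> bool" where
  "bidual_projection q \<longleftrightarrow> q \<odot> q = q \<and> bidual_adj q = q"

definition bidual_central :: "'a::cstar_algebra bidual \<Rightarrow> bool" where
  "bidual_central z \<longleftrightarrow> (\<forall>F. z \<odot> F = F \<odot> z)"

definition bidual_le :: "'a::cstar_algebra bidual \<Rightarrow> 'a bidual \<Rightarrow> bool" where
  "bidual_le F G \<longleftrightarrow> (\<exists>H. G - F = bidual_adj H \<odot> H)"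


section \<open>Von Neumann algebras, normal and singular functionals\<close>

text \<open>
  A von Neumann algebra is a C*-algebra \<open>M\<close> with a predual: a Banach space \<open>P\<close> together with
  an isometric linear isomorphism \<open>J\<close> of \<open>M\<close> onto \<open>P\<^sup>*\<close>. The predual is essentially unique
  (Sakai), so the weak* topology that \<open>J\<close> transports to \<open>M\<close> does not depend on \<open>J\<close>; for
  \<open>M\<close> acting on a Hilbert space it is the \<open>\<sigma>\<close>-weak topology.
\<close>

definition von_neumann_predual ::
    "('a::cstar_algebra \<Rightarrow> 'p::complex_banach cdual) \<Rightarrow> bool" where
  "von_neumann_predual J \<longleftrightarrow>
     (\<forall>x y. J (x + y) = J x + J y) \<and> (\<forall>c x. J (c *\<^sub>C x) = c *\<^sub>C J x) \<and>
     (\<forall>x. norm (J x) = norm x) \<and> surj J"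

definition vn_weak_star ::
    "('a::cstar_algebra \<Rightarrow> 'p::complex_banach cdual) \<Rightarrow> 'a topology" where
  "vn_weak_star J = pullback_topology UNIV J weak_star_topology"

definition normal_functionals ::
    "('a::cstar_algebra \<Rightarrow> 'p::complex_banach cdual) \<Rightarrow> 'a cdual set" where
  "normal_functionals J = {\<phi>. continuous_map (vn_weak_star J) euclidean (dual_apply \<phi>)}"

text \<open>
  \<open>cut F \<phi>\<close> is the functional \<open>\<phi>(F \<cdot>)\<close> on \<open>M\<close>: \<open>x \<mapsto> \<phi>(F x)\<close>, where \<open>F x\<close> is a product in
  \<open>M\<^sup>*\<^sup>*\<close> and \<open>\<phi>\<close> acts on \<open>M\<^sup>*\<^sup>*\<close> by evaluation.
\<close>

definition cut :: "'a::cstar_algebra bidual \<Rightarrow> 'a cdual \<Rightarrow> 'a cdual" where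
  "cut F \<phi> = Dual (\<lambda>x. dual_apply (F \<odot> canonical x) \<phi>)"

lemma cut_apply: "dual_apply (cut F \<phi>) x = dual_apply (F \<odot> canonical x) \<phi>"
proof -
  have 1: "bidual_act (canonical (x + y)) \<phi> = bidual_act (canonical x) \<phi> + bidual_act (canonical y) \<phi>" for x y
    by (rule dual_eqI) (simp add: distrib_left dual_apply_add)
  have 2: "bidual_act (canonical (c *\<^sub>C x)) \<phi> = c *\<^sub>C bidual_act (canonical x) \<phi>" for c x
    by (rule dual_eqI) (simp add: scaleC_mult_right dual_apply_scaleC)
  have n: "norm (canonical x) \<le> norm x" for x :: 'a
    by (rule norm_dual_le) (simp_all add: norm_dual_apply mult.commute[of "norm x"])
  have "norm (dual_apply F (bidual_act (canonical x) \<phi>)) \<le> norm x * (norm F * norm \<phi>)" for x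
  proof -
    have "norm (dual_apply F (bidual_act (canonical x) \<phi>)) \<le> norm F * norm (bidual_act (canonical x) \<phi>)"
      by (rule norm_dual_apply)
    also have "\<dots> \<le> norm F * (norm (canonical x) * norm \<phi>)"
      by (intro mult_left_mono norm_bidual_act norm_ge_zero)
    also have "\<dots> \<le> norm F * (norm x * norm \<phi>)"
      by (intro mult_left_mono mult_right_mono n norm_ge_zero)
    finally show ?thesis by (simp add: ac_simps)
  qed
  then have "dual_apply (cut F \<phi>) = (\<lambda>x. dual_apply (F \<odot> canonical x) \<phi>)"
    unfolding cut_def
    by (intro dual_apply_Dual) (auto simp: 1 2 dual_apply_add dual_apply_scaleC)
  then show ?thesis by simp
qed

text \<open>
  The characterization of the central projection \<open>z\<^sub>n\<close>; such a projection exists for every von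
  Neumann algebra and is unique.
\<close>

definition is_normal_part_projection ::
    "('a::cstar_algebra \<Rightarrow> 'p::complex_banach cdual) \<Rightarrow> 'a bidual \<Rightarrow> bool" where
  "is_normal_part_projection J z \<longleftrightarrow>
     bidual_projection z \<and> bidual_central z \<and> normal_functionals J = {\<phi>. \<phi> = cut z \<phi>}"

definition normal_part :: "'a::cstar_algebra bidual \<Rightarrow> 'a cdual \<Rightarrow> 'a cdual" where
  "normal_part z \<phi> = cut z \<phi>"

definition singular_part :: "'a::cstar_algebra bidual \<Rightarrow> 'a cdual \<Rightarrow> 'a cdual" where
  "singular_part z \<phi> = cut (canonical 1 - z) \<phi>"

definition singular :: "'a::cstar_algebra bidual \<Rightarrow> 'a cdual \<Rightarrow> bool" where
  "singular z \<phi> \<longleftrightarrow> \<phi> = singular_part z \<phi>"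

definition state :: "'a::cstar_algebra cdual \<Rightarrow> bool" where
  "state \<phi> \<longleftrightarrow>
     (\<forall>x. dual_apply \<phi> (adj x * x) \<in> \<real> \<and> 0 \<le> Re (dual_apply \<phi> (adj x * x))) \<and> norm \<phi> = 1"


section \<open>Ueda algebras\<close>

definition subalgebra :: "'a::cstar_algebra set \<Rightarrow> bool" where
  "subalgebra A \<longleftrightarrow> 0 \<in> A \<and> (\<forall>x\<in>A. \<forall>y\<in>A. x + y \<in> A \<and> x * y \<in> A) \<and> (\<forall>c. \<forall>x\<in>A. c *\<^sub>C x \<in> A)"

definition peak_projection :: "'a::cstar_algebra set \<Rightarrow> 'a bidual \<Rightarrow> bool" where
  "peak_projection A q \<longleftrightarrow> bidual_projection q \<and>
     (\<exists>a\<in>A. norm a \<le> 1 \<and> limitin weak_star_topology (\<lambda>n::nat. canonical (a ^ n)) q sequentially)"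

definition ueda_algebra ::
    "('a::cstar_algebra \<Rightarrow> 'p::complex_banach cdual) \<Rightarrow> 'a bidual \<Rightarrow> 'a set \<Rightarrow> bool" where
  "ueda_algebra J z A \<longleftrightarrow>
     subalgebra A \<and> closedin (vn_weak_star J) A \<and>
     (\<forall>\<phi>. state \<phi> \<and> singular z \<phi> \<longrightarrow>
        (\<exists>q. peak_projection A q \<and> dual_apply q \<phi> = 1 \<and> bidual_le q (canonical 1 - z)))"

definition annihilator :: "'a::cstar_algebra set \<Rightarrow> 'a cdual set" where
  "annihilator A = {\<phi>. \<forall>a\<in>A. dual_apply \<phi> a = 0}"

end

(* Write phi as a combination of four positive functionals and let sigma be the sum of their
   singular parts. The Ueda property gives a peak projection q <= 1 - z_n with
   sigma(q) = sigma(1). By the Cauchy-Schwarz inequality on the bidual, q acts as the identity on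
   every functional dominated by sigma and, because q <= 1 - z_n, annihilates the normal parts;
   hence phi(q x) = phi_s(x). If q is the weak* limit of a^n, then phi(q x) = lim phi(a^n x) = 0
   for x in A. Positivity in the C*-algebra is obtained without spectral theory, from the binomial
   series of the square root. *)

theory Submission
  imports Defs
begin

section \<open>Square roots and positive elements\<close>

text \<open>The Ueda property yields a projection for one singular state, while a single q has to
  serve all four positive functionals. Their singular parts are therefore summed and normalised
  first; 1 - q is nonnegative on each summand, so its vanishing on the sum descends to every one of
  them.

  What shapes the rest is that positivity has to be established at two levels. In M, the convexity
  argument behind the decomposition works with a cone given by a norm inequality, whereas positive
  functionals are defined through the elements x* x; that these lie in the cone is the hard
  algebraic fact, and commuting square roots replace functional calculus in its proof. In M**, the
  C*-structure is bypassed: (H* H)(\<psi>) >= 0 is shown for positive \<psi> in M* by approximating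
  a GNS vector, and this weak form suffices for a Cauchy-Schwarz argument with projections of M**.
  Weak* continuity of the Arens product enters only in the left factor, where it holds by
  construction.\<close>

instance cstar_algebra \<subseteq> banach ..

section \<open>Involution and complex scalars\<close>

lemma adj_scaleR: "adj (r *\<^sub>R x) = r *\<^sub>R adj (x :: 'a::cstar_algebra)"
  by (simp add: scaleR_scaleC adj_scaleC)

lemma bounded_linear_adj: "bounded_linear (adj :: 'a::cstar_algebra \<Rightarrow> 'a)"
  by (rule bounded_linear_intro[where K = 1]) (simp_all add: adj_add adj_scaleR norm_adj)

lemma adj_zero [simp]: "adj (0 :: 'a::cstar_algebra) = 0"
  using bounded_linear_adj linear_0 bounded_linear.linear by blast

lemma adj_minus: "adj (- x) = - adj (x :: 'a::cstar_algebra)"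
  using bounded_linear_adj linear_neg bounded_linear.linear by blast

lemma adj_diff: "adj (x - y) = adj x - adj (y :: 'a::cstar_algebra)"
  using bounded_linear_adj linear_diff bounded_linear.linear by blast

lemma adj_one [simp]: "adj (1 :: 'a::cstar_algebra) = 1"
  by (metis adj_adj adj_mult mult_1 mult_1_right)

lemma adj_power: "adj (x ^ n) = adj (x :: 'a::cstar_algebra) ^ n"
  by (induction n) (simp_all add: adj_mult power_commutes)

lemma scaleC_one [simp]: "1 *\<^sub>C x = (x :: 'a::complex_normed_vector)"
  using scaleR_scaleC[of 1 x] by simp

lemma scaleC_minus_right: "c *\<^sub>C (- x) = - (c *\<^sub>C (x :: 'a::complex_normed_vector))"
  using scaleC_add_right[of c x "- x"] by (simp add: scaleC_zero_right eq_neg_iff_add_eq_0 add.commute)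

lemma scaleC_minus_left: "(- c) *\<^sub>C x = - (c *\<^sub>C (x :: 'a::complex_normed_vector))"
proof -
  have "(- c) *\<^sub>C x = c *\<^sub>C ((-1) *\<^sub>C x)" by (simp add: scaleC_scaleC)
  also have "(-1) *\<^sub>C x = - x" using scaleR_scaleC[of "-1" x] by simp
  finally show ?thesis by (simp add: scaleC_minus_right)
qed

lemma scaleC_diff_right: "c *\<^sub>C (x - y) = c *\<^sub>C x - c *\<^sub>C (y :: 'a::complex_normed_vector)"
  using scaleC_add_right[of c x "- y"] by (simp add: scaleC_minus_right)

section \<open>The binomial series of the square root\<close>

text \<open>Taylor coefficients of (1 - x)^(1/2) at 0: 1, -1/2, -1/8, ...\<close>

definition sqrt_coeff :: "nat \<Rightarrow> real"
  where "sqrt_coeff n = (- 1) ^ n * (1/2 gchoose n)"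

lemma sqrt_coeff_pochhammer: "sqrt_coeff n = pochhammer (- 1/2) n / fact n"
proof -
  have "(- 1) ^ n * (- 1) ^ n = (1::real)" by (simp flip: power_mult_distrib)
  then show ?thesis by (simp add: sqrt_coeff_def gbinomial_pochhammer)
qed

text \<open>In the rising factorial of -1/2 only the first factor is negative.\<close>

lemma sqrt_coeff_nonpos: "n > 0 \<Longrightarrow> sqrt_coeff n \<le> 0"
  by (cases n) (simp_all add: sqrt_coeff_pochhammer pochhammer_rec pochhammer_nonneg divide_nonpos_pos)

text \<open>Only the zeroth coefficient is positive, so the absolute sum is 2 minus the plain
  partial sum, which has the nonnegative closed form \<open>pochhammer (1/2) m / fact m\<close>.
  Hence the series converges absolutely up to and including the boundary norm 1.\<close>

lemma sum_abs_sqrt_coeff_le: "(\<Sum>k<n. \<bar>sqrt_coeff k\<bar>) \<le> 2"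
proof (cases n)
  case (Suc m)
  have "(\<Sum>k\<le>m. \<bar>sqrt_coeff k\<bar>) = 2 - (\<Sum>k\<le>m. sqrt_coeff k)"
  proof (induction m)
    case (Suc m)
    then show ?case using sqrt_coeff_nonpos[of "Suc m"] by simp
  qed (simp add: sqrt_coeff_def)
  also have "(\<Sum>k\<le>m. sqrt_coeff k) = (- 1) ^ m * (- 1/2 gchoose m)"
    using gbinomial_sum_lower_neg[of "1/2::real" m] by (simp add: sqrt_coeff_def mult.commute)
  also have "\<dots> = pochhammer (1/2) m / fact m"
  proof -
    have "(- 1) ^ m * (- 1) ^ m = (1::real)" by (simp flip: power_mult_distrib)
    then show ?thesis by (simp add: gbinomial_pochhammer)
  qed
  finally have "(\<Sum>k\<le>m. \<bar>sqrt_coeff k\<bar>) = 2 - pochhammer (1/2) m / fact m" .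
  moreover have "pochhammer (1/2) m / fact m \<ge> (0::real)" by (simp add: pochhammer_nonneg)
  ultimately show ?thesis using Suc by (simp add: lessThan_Suc_atMost)
qed simp

lemma summable_sqrt_coeff: "summable (\<lambda>n. \<bar>sqrt_coeff n\<bar>)"
  by (rule summableI_nonneg_bounded[OF _ sum_abs_sqrt_coeff_le]) simp

text \<open>Squaring the series, coefficient by coefficient: Vandermonde with 1/2 + 1/2 = 1 leaves
  the coefficients of 1 - x.\<close>

lemma sqrt_coeff_convolution:
  "(\<Sum>i\<le>n. sqrt_coeff i * sqrt_coeff (n - i)) = (if n = 0 then 1 else if n = 1 then - 1 else 0)"
proof -
  have "(\<Sum>i\<le>n. sqrt_coeff i * sqrt_coeff (n - i))
      = (\<Sum>i\<le>n. (- 1) ^ n * ((1/2 gchoose i) * (1/2 gchoose (n - i))))"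
    by (rule sum.cong) (auto simp: sqrt_coeff_def mult_ac simp flip: power_add)
  also have "\<dots> = (- 1) ^ n * (1 gchoose n)"
    using gbinomial_Vandermonde[of "1/2::real" "1/2" n]
    by (simp add: sum_distrib_left[symmetric] atMost_atLeast0)
  also have "(1 gchoose n) = real (1 choose n)" by (simp add: binomial_gbinomial)
  finally show ?thesis by (cases "n \<le> 1") (auto simp: le_Suc_eq)
qed

text \<open>For \<open>norm a \<le> 1\<close> this is a square root of 1 - a, not of a.\<close>

definition sqrt_series :: "'a::cstar_algebra \<Rightarrow> 'a"
  where "sqrt_series a = (\<Sum>n. sqrt_coeff n *\<^sub>R a ^ n)"

context
  fixes a :: "'a::cstar_algebra"
  assumes norm_a: "norm a \<le> 1"
begin

lemma summable_norm_sqrt_series: "summable (\<lambda>n. norm (sqrt_coeff n *\<^sub>R a ^ n))"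
proof (rule summable_comparison_test'[OF summable_sqrt_coeff])
  fix n
  have "norm (a ^ n) \<le> 1" using norm_power_ineq[of a n] norm_a
    by (meson norm_ge_zero order_trans power_le_one)
  then show "norm (norm (sqrt_coeff n *\<^sub>R a ^ n)) \<le> \<bar>sqrt_coeff n\<bar>"
    by (simp add: mult_left_le)
qed

lemma summable_sqrt_series: "summable (\<lambda>n. sqrt_coeff n *\<^sub>R a ^ n)"
  using summable_norm_sqrt_series by (rule summable_norm_cancel)

lemma sqrt_series_square: "sqrt_series a * sqrt_series a = 1 - a"
proof -
  let ?c = "\<lambda>n::nat. (if n = 0 then 1 else if n = 1 then - 1 else 0 :: real)"
  have "(\<Sum>i\<le>n. (sqrt_coeff i *\<^sub>R a ^ i) * (sqrt_coeff (n - i) *\<^sub>R a ^ (n - i))) = ?c n *\<^sub>R a ^ n" for n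
  proof -
    have "(\<Sum>i\<le>n. (sqrt_coeff i *\<^sub>R a ^ i) * (sqrt_coeff (n - i) *\<^sub>R a ^ (n - i)))
      = (\<Sum>i\<le>n. (sqrt_coeff i * sqrt_coeff (n - i)) *\<^sub>R a ^ n)"
      by (rule sum.cong) (auto simp: mult.commute simp flip: power_add)
    then show ?thesis by (simp only: scaleR_sum_left[symmetric] sqrt_coeff_convolution)
  qed
  then have "(\<lambda>n. ?c n *\<^sub>R a ^ n) sums (sqrt_series a * sqrt_series a)"
    using Cauchy_product_sums[OF summable_norm_sqrt_series summable_norm_sqrt_series]
    by (simp add: sqrt_series_def)
  moreover have "(\<lambda>n. ?c n *\<^sub>R a ^ n) sums (\<Sum>n\<in>{0,1}. ?c n *\<^sub>R a ^ n)"
    by (rule sums_finite) auto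
  ultimately show ?thesis using sums_unique2 by fastforce
qed

text \<open>Puts the root itself into the cone \<open>cpos\<close>, with t = 1. The bound is the
  absolute coefficient sum without its zeroth term, at most 2 - 1.\<close>

lemma norm_one_minus_sqrt_series: "norm (1 - sqrt_series a) \<le> 1"
proof -
  have "sqrt_series a = (\<Sum>n. sqrt_coeff (Suc n) *\<^sub>R a ^ Suc n) + sqrt_coeff 0 *\<^sub>R a ^ 0"
    unfolding sqrt_series_def using suminf_split_head[OF summable_sqrt_series] by simp
  then have "norm (1 - sqrt_series a) = norm (\<Sum>n. sqrt_coeff (Suc n) *\<^sub>R a ^ Suc n)"
    by (simp add: sqrt_coeff_def norm_minus_commute del: power_Suc)
  also have "\<dots> \<le> (\<Sum>n. \<bar>sqrt_coeff (Suc n)\<bar>)"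
  proof (rule norm_suminf_le)
    show "norm (sqrt_coeff (Suc n) *\<^sub>R a ^ Suc n) \<le> \<bar>sqrt_coeff (Suc n)\<bar>" for n
    proof -
      have "norm (a ^ Suc n) \<le> 1" using norm_power_ineq[of a "Suc n"] norm_a
        by (meson norm_ge_zero order_trans power_le_one)
      then show ?thesis by (simp add: mult_left_le del: power_Suc)
    qed
    show "summable (\<lambda>n. \<bar>sqrt_coeff (Suc n)\<bar>)"
      using summable_sqrt_coeff by (simp add: summable_Suc_iff[of "\<lambda>n. \<bar>sqrt_coeff n\<bar>"])
  qed
  also have "\<dots> = (\<Sum>n. \<bar>sqrt_coeff n\<bar>) - 1"
    using suminf_split_head[OF summable_sqrt_coeff] by (simp add: sqrt_coeff_def)
  also have "\<dots> \<le> 1"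
    using suminf_le_const[OF summable_sqrt_coeff sum_abs_sqrt_coeff_le] by simp
  finally show ?thesis .
qed

lemma adj_sqrt_series: "adj a = a \<Longrightarrow> adj (sqrt_series a) = sqrt_series a"
  unfolding sqrt_series_def
  by (simp add: bounded_linear.suminf[OF bounded_linear_adj summable_sqrt_series] adj_scaleR adj_power)

lemma sqrt_series_commute:
  assumes "y * a = a * y"
  shows "y * sqrt_series a = sqrt_series a * y"
proof -
  have "y * a ^ n = a ^ n * y" for n
    using assms by (metis power_commuting_commutes)
  then show ?thesis unfolding sqrt_series_def
    by (simp add: suminf_mult[OF summable_sqrt_series, symmetric]
        suminf_mult2[OF summable_sqrt_series])
qed

end

text \<open>For self-adjoint \<open>b\<close> the norm condition says that the spectrum of \<open>b\<close> lies in \<open>[0, 2 t]\<close>; in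
  this form closure under sums is immediate.\<close>

definition cpos :: "'a::cstar_algebra \<Rightarrow> bool"
  where "cpos b \<longleftrightarrow> adj b = b \<and> (\<exists>t\<ge>0. norm (t *\<^sub>R 1 - b) \<le> t)"

lemma cposI: "adj b = b \<Longrightarrow> 0 \<le> t \<Longrightarrow> norm (t *\<^sub>R 1 - b) \<le> t \<Longrightarrow> cpos b"
  by (auto simp: cpos_def)

lemma cpos_sa: "cpos b \<Longrightarrow> adj b = b"
  by (simp add: cpos_def)

lemma cpos_zero [simp]: "cpos 0"
  by (rule cposI[where t = 0]) auto

lemma cpos_add:
  assumes "cpos a" "cpos b" shows "cpos (a + b)"
proof -
  obtain s t where st: "s \<ge> 0" "norm (s *\<^sub>R 1 - a) \<le> s" "t \<ge> 0" "norm (t *\<^sub>R 1 - b) \<le> t"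
    using assms by (auto simp: cpos_def)
  have "(s + t) *\<^sub>R 1 - (a + b) = (s *\<^sub>R 1 - a) + (t *\<^sub>R 1 - b)" by (simp add: algebra_simps)
  then have "norm ((s + t) *\<^sub>R 1 - (a + b)) \<le> s + t"
    using st norm_triangle_mono by metis
  with st show ?thesis using assms by (intro cposI[where t = "s + t"]) (auto simp: cpos_def adj_add)
qed

lemma cpos_scaleR:
  assumes "cpos b" "0 \<le> r" shows "cpos (r *\<^sub>R b)"
proof -
  obtain t where t: "t \<ge> 0" "norm (t *\<^sub>R 1 - b) \<le> t" using assms by (auto simp: cpos_def)
  have "norm ((r * t) *\<^sub>R 1 - r *\<^sub>R b) = r * norm (t *\<^sub>R 1 - b)"
    using assms(2) by (metis scaleR_scaleR scaleR_diff_right norm_scaleR abs_of_nonneg)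
  with t assms show ?thesis
    by (intro cposI[where t = "r * t"]) (auto simp: cpos_def adj_scaleR mult_left_mono)
qed

text \<open>The triangle inequality allows the radius to grow; a positive one is needed in order to
  divide by it.\<close>

lemma cpos_radius:
  assumes "cpos b" obtains t where "t > 0" "norm (t *\<^sub>R 1 - b) \<le> t"
proof -
  obtain t where t: "t \<ge> 0" "norm (t *\<^sub>R 1 - b) \<le> t" using assms by (auto simp: cpos_def)
  have "(t + 1) *\<^sub>R 1 - b = (t *\<^sub>R 1 - b) + 1" by (simp add: algebra_simps)
  then have "norm ((t + 1) *\<^sub>R 1 - b) \<le> t + 1"
    using t(2) norm_triangle_mono[of "t *\<^sub>R 1 - b" t 1 1] by (simp only: norm_one order_refl)
  with t(1) show ?thesis by (intro that[of "t + 1"]) simp_all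
qed

text \<open>Dividing by the radius t gives b the form t (1 - a) with \<open>norm a \<le> 1\<close>.
  The root is a limit of polynomials in b, hence commutes with everything that commutes with b; this
  clause does the work of functional calculus below.\<close>

lemma cpos_sqrt:
  fixes b :: "'a::cstar_algebra"
  assumes "cpos b"
  obtains c where "cpos c" "c * c = b" "\<And>y. y * b = b * y \<Longrightarrow> y * c = c * y"
proof -
  obtain t where t: "t > 0" "norm (t *\<^sub>R 1 - b) \<le> t" using assms by (rule cpos_radius)
  define a where "a = 1 - (1/t) *\<^sub>R b"
  have "a = (1/t) *\<^sub>R (t *\<^sub>R 1 - b)" using t by (simp add: a_def scaleR_diff_right)
  then have a: "norm a \<le> 1" using t by simp
  have sa: "adj a = a" using assms by (simp add: a_def adj_diff adj_scaleR cpos_def)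
  show ?thesis
  proof (rule that[of "sqrt t *\<^sub>R sqrt_series a"])
    show "cpos (sqrt t *\<^sub>R sqrt_series a)"
      using norm_one_minus_sqrt_series[OF a] t
      by (intro cpos_scaleR cposI[where t = 1]) (simp_all add: adj_sqrt_series[OF a sa])
    show "(sqrt t *\<^sub>R sqrt_series a) * (sqrt t *\<^sub>R sqrt_series a) = b"
    proof -
      have "(sqrt t *\<^sub>R sqrt_series a) * (sqrt t *\<^sub>R sqrt_series a) = t *\<^sub>R (1 - a)"
        using t by (simp add: sqrt_series_square[OF a])
      then show ?thesis using t by (simp add: a_def)
    qed
    fix y assume "y * b = b * y"
    then have "y * a = a * y"
      unfolding a_def by (simp only: left_diff_distrib right_diff_distrib mult_scaleR_left mult_scaleR_right mult_1 mult_1_right)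
    from sqrt_series_commute[OF a this]
    show "y * (sqrt t *\<^sub>R sqrt_series a) = sqrt t *\<^sub>R sqrt_series a * y"
      by (simp only: mult_scaleR_left mult_scaleR_right)
  qed
qed

lemma cpos_one_minus:
  assumes "adj k = k" "norm k \<le> s" shows "cpos (s *\<^sub>R 1 - k)"
  using assms order_trans[OF norm_ge_zero assms(2)]
  by (intro cposI[where t = s]) (auto simp: adj_diff adj_scaleR)

text \<open>For \<open>u = c + i d\<close> one has \<open>u\<^sup>* u = c\<^sup>2 + d\<^sup>2 = s\<close>, and \<open>c\<close> is the real part of \<open>u\<close>.\<close>

lemma norm_le_of_sum_squares:
  fixes c d :: "'a::cstar_algebra"
  assumes "adj c = c" "adj d = d" "c * d = d * c" "c * c + d * d = s *\<^sub>R 1" "0 \<le> s"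
  shows "(norm c)\<^sup>2 \<le> s"
proof -
  define u where "u = c + \<i> *\<^sub>C d"
  have au: "adj u = c - \<i> *\<^sub>C d"
    using assms by (simp add: u_def adj_add adj_scaleC scaleC_minus_left)
  have ii: "\<i> *\<^sub>C \<i> *\<^sub>C x = - x" for x :: 'a
    using scaleC_minus_left[of 1 x] by (simp add: scaleC_scaleC)
  have "adj u * u = c * c + d * d"
    unfolding au using assms
    by (simp add: u_def distrib_left left_diff_distrib scaleC_mult_left scaleC_mult_right
        scaleC_diff_right ii)
  then have nu: "(norm u)\<^sup>2 = s" using assms cstar_identity[of u] by simp
  have "u + adj u = 2 *\<^sub>R c" unfolding au by (simp add: u_def scaleR_2)
  then have "norm c = norm (u + adj u) / 2" by simp
  also have "\<dots> \<le> norm u" using norm_triangle_ineq[of u "adj u"] by (simp add: norm_adj)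
  finally show ?thesis using nu power_mono[of "norm c" "norm u" 2] by simp
qed

text \<open>After scaling to \<open>norm k \<le> 1\<close> it suffices that 1 - k^2 has norm at most
  1. Its root d satisfies d^2 + k^2 = 1, which bounds d, and 1 - k^2 = d^2.\<close>

lemma cpos_square:
  fixes k :: "'a::cstar_algebra"
  assumes "adj k = k" shows "cpos (k * k)"
proof -
  have *: "cpos (k * k)" if k: "adj k = k" "norm k \<le> 1" for k :: 'a
  proof -
    have n: "norm (k * k) \<le> 1"
      using norm_mult_ineq[of k k] k mult_le_one[of "norm k" "norm k"] by simp
    define d where "d = sqrt_series (k * k)"
    have d: "d * d = 1 - k * k" "adj d = d" "k * d = d * k"
      unfolding d_def using n k
      by (auto simp: sqrt_series_square adj_sqrt_series adj_mult sqrt_series_commute mult.assoc)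
    have "(norm d)\<^sup>2 \<le> 1"
      by (rule norm_le_of_sum_squares[of d k]) (use d k in auto)
    then have "norm (1 - k * k) \<le> 1"
      using norm_mult_ineq[of d d] d by (simp add: power2_eq_square)
    then show ?thesis using k by (intro cposI[where t = 1]) (auto simp: adj_mult)
  qed
  show ?thesis
  proof (cases "k = 0")
    case False
    have "cpos ((k /\<^sub>R norm k) * (k /\<^sub>R norm k))"
      using assms False by (intro *) (auto simp: adj_scaleR)
    then have "cpos ((norm k)\<^sup>2 *\<^sub>R ((k /\<^sub>R norm k) * (k /\<^sub>R norm k)))"
      by (rule cpos_scaleR) simp
    also have "(norm k)\<^sup>2 *\<^sub>R ((k /\<^sub>R norm k) * (k /\<^sub>R norm k)) = k * k"
      using False by (simp add: power2_eq_square divide_simps)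
    finally show ?thesis .
  qed simp
qed

text \<open>Commuting roots c of b and d of s - b satisfy c^2 + d^2 = s, so the norm of b = c^2 is
  at most s.\<close>

lemma norm_le_of_cpos:
  assumes "cpos b" "cpos (s *\<^sub>R 1 - b)" "0 \<le> s"
  shows "norm b \<le> s"
proof -
  obtain c where c: "adj c = c" "c * c = b" "\<And>y. y * b = b * y \<Longrightarrow> y * c = c * y"
    using cpos_sqrt[OF assms(1)] cpos_sa by metis
  obtain d where d: "adj d = d" "d * d = s *\<^sub>R 1 - b"
      "\<And>y. y * (s *\<^sub>R 1 - b) = (s *\<^sub>R 1 - b) * y \<Longrightarrow> y * d = d * y"
    using cpos_sqrt[OF assms(2)] cpos_sa by metis
  have "c * b = b * c" using c(2) by (metis mult.assoc)
  then have cd: "c * d = d * c" by (intro d(3)) (simp add: algebra_simps)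
  have "(norm c)\<^sup>2 \<le> s"
    by (rule norm_le_of_sum_squares[OF c(1) d(1) cd _ assms(3)]) (simp add: c(2) d(2))
  then show ?thesis using norm_mult_ineq[of c c] c(2) by (simp add: power2_eq_square)
qed

lemma norm_mono_cpos:
  assumes "cpos a" "cpos b" "cpos (b - a)" shows "norm a \<le> norm b"
proof (rule norm_le_of_cpos)
  have "cpos ((norm b *\<^sub>R 1 - b) + (b - a))"
    by (intro cpos_add cpos_one_minus assms cpos_sa order_refl)
  then show "cpos (norm b *\<^sub>R 1 - a)" by simp
qed (use assms in auto)

section \<open>Positivity of x* x\<close>

text \<open>Powers of b are squares of powers of its root, and the induction expands the factors 1 +
  b. This supplies the positive terms that are discarded when b (1 + b)^n is compared with n
  b^2.\<close>

lemma cpos_power_mult: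
  fixes b :: "'a::cstar_algebra"
  assumes "cpos b" shows "cpos (b ^ k * (1 + b) ^ n)"
proof (induction n arbitrary: k)
  case 0
  obtain c where c: "adj c = c" "c * c = b" using cpos_sqrt[OF assms] cpos_sa by metis
  have "b ^ k = c ^ k * c ^ k" using c(2) by (metis power2_eq_square power_mult power_commutes mult.commute)
  then show ?case using c cpos_square[of "c ^ k"] by (simp add: adj_power)
next
  case (Suc n)
  have "b ^ k * (1 + b) ^ Suc n = b ^ k * (1 + b) ^ n + b ^ Suc k * (1 + b) ^ n"
    by (simp add: distrib_left distrib_right power_commutes flip: mult.assoc)
  with Suc cpos_add show ?case by metis
qed

text \<open>c and d are, up to sign, twice the real and imaginary parts of y, and the sum is half of
  c^2 + d^2. It makes y y* positive as soon as -(y* y) is.\<close>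

lemma cpos_adj_sum:
  fixes y :: "'a::cstar_algebra"
  shows "cpos (adj y * y + y * adj y)"
proof -
  define c where "c = y + adj y"
  define d where "d = \<i> *\<^sub>C (y - adj y)"
  have ii: "\<i> *\<^sub>C \<i> *\<^sub>C x = - x" for x :: 'a
    using scaleC_minus_left[of 1 x] by (simp add: scaleC_scaleC)
  have c: "adj c = c" by (simp add: c_def adj_add adj_adj add.commute)
  have d: "adj d = d" by (simp add: d_def adj_scaleC adj_diff adj_adj scaleC_minus_left scaleC_diff_right)
  have "adj y * y + y * adj y = (1/2) *\<^sub>R (c * c + d * d)"
  proof -
    have "d * d = - ((y - adj y) * (y - adj y))"
      by (simp add: d_def scaleC_mult_left scaleC_mult_right ii)
    then have "c * c + d * d = 2 *\<^sub>R (adj y * y + y * adj y)"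
      by (simp add: c_def algebra_simps scaleR_2)
    then show ?thesis by simp
  qed
  moreover have "cpos (c * c + d * d)" by (intro cpos_add cpos_square c d)
  ultimately show ?thesis by (simp add: cpos_scaleR)
qed

text \<open>If \<open>y\<^sup>* y \<le> 0\<close>, then \<open>\<parallel>1 + y\<^sup>* y\<parallel> \<le> 1\<close> after scaling, so \<open>b (1 + b)\<^sup>n = y (1 + y\<^sup>* y)\<^sup>n y\<^sup>*\<close> is
  bounded in \<open>n\<close> for \<open>b = y y\<^sup>* \<ge> 0\<close>, while it dominates \<open>n b\<^sup>2\<close>.\<close>

lemma cpos_minus_adj_mult_imp_zero:
  fixes y :: "'a::cstar_algebra"
  assumes "cpos (- (adj y * y))" shows "y = 0"
proof -
  obtain t where t: "t > 0" "norm (t *\<^sub>R 1 - - (adj y * y)) \<le> t"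
    using assms by (rule cpos_radius)
  define x where "x = (1 / sqrt t) *\<^sub>R y"
  define a where "a = adj x * x"
  define b where "b = x * adj x"
  have a: "a = (1/t) *\<^sub>R (adj y * y)" using t by (simp add: a_def x_def adj_scaleR)
  have "1 + a = (1/t) *\<^sub>R (t *\<^sub>R 1 - - (adj y * y))" using t by (simp add: a scaleR_add_right)
  then have n1: "norm (1 + a) \<le> 1" using t by simp
  have na: "cpos (- a)" using cpos_scaleR[OF assms, of "1/t"] t by (simp add: a)
  have "b = (a + b) + - a" by simp
  moreover have "cpos (a + b)" unfolding a_def b_def by (rule cpos_adj_sum)
  ultimately have b: "cpos b" using na cpos_add by metis
  have conj: "b * (1 + b) ^ n = x * (1 + a) ^ n * adj x" for n
  proof -
    have "x * (1 + a) ^ n = (1 + b) ^ n * x"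
    proof (induction n)
      case (Suc n)
      have "x * (1 + a) = (1 + b) * x" by (simp add: a_def b_def distrib_left distrib_right mult.assoc)
      then have "x * (1 + a) ^ Suc n = (1 + b) * (x * (1 + a) ^ n)" by (simp flip: mult.assoc)
      with Suc show ?case by (simp flip: mult.assoc)
    qed simp
    then have "x * (1 + a) ^ n * adj x = (1 + b) ^ n * b" by (simp add: b_def mult.assoc)
    also have "\<dots> = b * (1 + b) ^ n"
      by (rule power_commuting_commutes) (simp add: algebra_simps)
    finally show ?thesis by simp
  qed
  \<comment> \<open>Passing from n to n + 1 adds b^2 (1 + b)^n, which exceeds b^2 by a sum of
    positive terms b^3 (1 + b)^m; the norm is monotone on the cone.\<close>
  have ineq: "real n * norm (b * b) \<le> (norm x)\<^sup>2" for n
  proof -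
    have "cpos (b * (1 + b) ^ n - real n *\<^sub>R (b * b))"
    proof (induction n)
      case (Suc n)
      have "cpos (b * b * (1 + b) ^ n - b * b)"
      proof (induction n)
        case (Suc n)
        have "b * b * (1 + b) ^ Suc n - b * b = (b * b * (1 + b) ^ n - b * b) + b ^ 3 * (1 + b) ^ n"
          by (simp add: distrib_left distrib_right power_commutes power3_eq_cube algebra_simps)
        then show ?case using Suc cpos_add cpos_power_mult[OF b, of 3 n] by metis
      qed simp
      moreover have "b * (1 + b) ^ Suc n - real (Suc n) *\<^sub>R (b * b)
          = (b * (1 + b) ^ n - real n *\<^sub>R (b * b)) + (b * b * (1 + b) ^ n - b * b)"
        by (simp add: algebra_simps)
      ultimately show ?case using Suc cpos_add by metis
    qed (use b in simp)
    moreover have "cpos (real n *\<^sub>R (b * b))" by (intro cpos_scaleR cpos_square cpos_sa b) simp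
    moreover have "cpos (b * (1 + b) ^ n)" using cpos_power_mult[OF b, of 1 n] by simp
    ultimately have "norm (real n *\<^sub>R (b * b)) \<le> norm (b * (1 + b) ^ n)" by (intro norm_mono_cpos)
    also have "\<dots> \<le> norm x * 1 * norm (adj x)"
    proof -
      have "norm ((1 + a) ^ n) \<le> 1" using norm_power_ineq[of "1 + a" n] n1
        by (meson norm_ge_zero order_trans power_le_one)
      then have "norm (x * (1 + a) ^ n) \<le> norm x * 1"
        using norm_mult_ineq[of x "(1 + a) ^ n"] by (meson mult_left_mono norm_ge_zero order_trans)
      then show ?thesis unfolding conj
        using norm_mult_ineq[of "x * (1 + a) ^ n" "adj x"] by (meson mult_right_mono norm_ge_zero order_trans)
    qed
    finally show ?thesis by (simp add: norm_adj power2_eq_square)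
  qed
  have "norm (b * b) = 0"
  proof (rule ccontr)
    assume "norm (b * b) \<noteq> 0"
    then obtain n where "(norm x)\<^sup>2 < real n * norm (b * b)"
      using reals_Archimedean3[of "norm (b * b)"] by auto
    with ineq[of n] show False by simp
  qed
  then have "norm b = 0" using cstar_identity[of b] cpos_sa[OF b] by simp
  then have "norm (adj x) = 0" using cstar_identity[of "adj x"] by (simp add: b_def adj_adj)
  then show ?thesis using t by (simp add: x_def norm_adj)
qed

text \<open>For \<open>h = x\<^sup>* x\<close>, \<open>s = \<bar>h\<bar>\<close> and \<open>y = x (s - h)\<close> one has \<open>y\<^sup>* y = - s (s - h)\<^sup>2 \<le> 0\<close>; hence
  \<open>y = 0\<close>, which forces \<open>h = s\<close>.\<close>

lemma cpos_adj_mult: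
  fixes x :: "'a::cstar_algebra"
  shows "cpos (adj x * x)"
proof -
  define h where "h = adj x * x"
  have h: "adj h = h" by (simp add: h_def adj_mult adj_adj)
  obtain s where s: "cpos s" "s * s = h * h" "\<And>y. y * (h * h) = h * h * y \<Longrightarrow> y * s = s * y"
    using cpos_sqrt[OF cpos_square[OF h]] by metis
  have hs: "h * s = s * h" by (rule s(3)) (simp add: mult.assoc)
  \<comment> \<open>The root of s is taken because it commutes with v = s - h: s v^2 becomes the
    square of the self-adjoint element r v.\<close>
  obtain r where r: "cpos r" "r * r = s" "\<And>y. y * s = s * y \<Longrightarrow> y * r = r * y"
    using cpos_sqrt[OF s(1)] by metis
  have hr: "h * r = r * h" by (rule r(3)) (rule hs)
  have sr: "s * r = r * s" by (rule r(3)) simp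
  define v where "v = s - h"
  have v: "adj v = v" using h cpos_sa[OF s(1)] by (simp add: v_def adj_diff)
  have vr: "v * r = r * v" using hr sr by (simp add: v_def algebra_simps)
  have vh: "v * h = - (s * v)"
    using s(2) by (simp add: v_def left_diff_distrib right_diff_distrib)
  have rv: "adj (r * v) = r * v" using v vr cpos_sa[OF r(1)] by (simp add: adj_mult)
  have "adj (x * v) * (x * v) = (v * h) * v" by (simp add: adj_mult v h_def mult.assoc)
  also have "\<dots> = - ((r * v) * (r * v))"
    using vr by (metis vh r(2) mult.assoc mult_minus_left)
  finally have y: "- (adj (x * v) * (x * v)) = (r * v) * (r * v)" by simp
  then have "x * v = 0"
    using cpos_square[OF rv] by (intro cpos_minus_adj_mult_imp_zero) simp
  with y have "(r * v) * (r * v) = 0" by simp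
  then have "r * v = 0" using cstar_identity[of "r * v"] rv by simp
  \<comment> \<open>Both s and h annihilate v = s - h, so v^2 = 0 and v = 0 by the
    C*-identity.\<close>
  then have sv: "s * v = 0" using r(2) by (metis mult.assoc mult_zero_right)
  then have "h * v = 0" using vh hs by (simp add: v_def algebra_simps)
  with sv have "v * v = 0" by (metis v_def left_diff_distrib diff_zero)
  then have "v = 0" using cstar_identity[of v] v by simp
  then show ?thesis using s(1) by (simp add: v_def flip: h_def)
qed

section \<open>Jordan decomposition of functionals\<close>

text \<open>A form of the Hahn--Banach theorem: \<open>S\<close> plays the role of the epigraph of a sublinear
  functional, and a maximal cone containing \<open>S\<close> is the epigraph of a linear one.\<close>

lemma linear_below_cone:
  fixes S :: "('a::real_vector \<times> real) set"
  assumes add: "\<And>p q. p \<in> S \<Longrightarrow> q \<in> S \<Longrightarrow> p + q \<in> S"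
    and scale: "\<And>c p. 0 \<le> c \<Longrightarrow> p \<in> S \<Longrightarrow> c *\<^sub>R p \<in> S"
    and dom: "\<And>x. \<exists>r. (x, r) \<in> S"
    and pos: "\<And>r. (0, r) \<in> S \<Longrightarrow> 0 \<le> r"
  obtains f where "linear f" "\<And>x r. (x, r) \<in> S \<Longrightarrow> f x \<le> r"
proof -
  define \<F> where "\<F> = {T. S \<subseteq> T \<and> (\<forall>p\<in>T. \<forall>q\<in>T. p + q \<in> T) \<and>
    (\<forall>c p. 0 \<le> c \<longrightarrow> p \<in> T \<longrightarrow> c *\<^sub>R p \<in> T) \<and> (\<forall>r. (0, r) \<in> T \<longrightarrow> 0 \<le> r)}"
  have \<F>S: "S \<subseteq> X"
    and \<F>add: "p \<in> X \<Longrightarrow> q \<in> X \<Longrightarrow> p + q \<in> X"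
    and \<F>scale: "0 \<le> c \<Longrightarrow> p \<in> X \<Longrightarrow> c *\<^sub>R p \<in> X"
    and \<F>pos: "(0, r) \<in> X \<Longrightarrow> 0 \<le> r" if "X \<in> \<F>" for X p q c r
    using that unfolding \<F>_def by blast+
  have \<F>I: "X \<in> \<F>" if "S \<subseteq> X" "\<And>p q. p \<in> X \<Longrightarrow> q \<in> X \<Longrightarrow> p + q \<in> X"
    "\<And>c p. 0 \<le> c \<Longrightarrow> p \<in> X \<Longrightarrow> c *\<^sub>R p \<in> X" "\<And>r. (0, r) \<in> X \<Longrightarrow> 0 \<le> r" for X
    using that unfolding \<F>_def by blast
  have "\<exists>T\<in>\<F>. \<forall>X\<in>\<F>. T \<subseteq> X \<longrightarrow> X = T"
  proof (rule subset_Zorn_nonempty)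
    show "\<F> \<noteq> {}" using \<F>I[OF _ add scale pos] by blast
    fix \<C> assume ne: "\<C> \<noteq> {}" and ch: "subset.chain \<F> \<C>"
    then have sub: "\<C> \<subseteq> \<F>" and tot: "\<And>X Y. X \<in> \<C> \<Longrightarrow> Y \<in> \<C> \<Longrightarrow> X \<subseteq> Y \<or> Y \<subseteq> X"
      by (auto simp: subset_chain_def)
    show "\<Union>\<C> \<in> \<F>"
    proof (rule \<F>I)
      fix p q assume "p \<in> \<Union>\<C>" "q \<in> \<Union>\<C>"
      then obtain X Y where "X \<in> \<C>" "Y \<in> \<C>" "p \<in> X" "q \<in> Y" by blast
      then obtain Z where "Z \<in> \<C>" "p \<in> Z" "q \<in> Z" using tot[of X Y] by blast
      then show "p + q \<in> \<Union>\<C>" using sub \<F>add by blast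
    qed (use ne sub \<F>S \<F>scale \<F>pos in blast)+
  qed
  then obtain T where T: "T \<in> \<F>" and max: "\<And>X. X \<in> \<F> \<Longrightarrow> T \<subseteq> X \<Longrightarrow> X = T" by blast
  have ST: "S \<subseteq> T" and Tadd: "\<And>p q. p \<in> T \<Longrightarrow> q \<in> T \<Longrightarrow> p + q \<in> T"
    and Tscale: "\<And>c p. 0 \<le> c \<Longrightarrow> p \<in> T \<Longrightarrow> c *\<^sub>R p \<in> T"
    and Tpos: "\<And>r. (0, r) \<in> T \<Longrightarrow> 0 \<le> r"
    using T \<F>S \<F>add \<F>scale \<F>pos by blast+
  \<comment> \<open>By maximality, adjoining the ray through (x, r) destroys the condition at 0:
    some (y, u) in T has y + c x = 0 and u + c r < 0. Here c > 0, as T itself satisfies that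
    condition, and division by c gives the claim.\<close>
  have opposite: "\<exists>u. (- x, u) \<in> T \<and> u < - r" if "(x, r) \<notin> T" for x r
  proof -
    define X where "X = {p + c *\<^sub>R (x, r) |p c. p \<in> T \<and> 0 \<le> c}"
    have zT: "0 \<in> T"
      using dom[of 0] ST Tscale[of 0] by fastforce
    have XI: "p + c *\<^sub>R (x, r) \<in> X" if "p \<in> T" "0 \<le> c" for p c
      unfolding X_def using that by blast
    have TX: "T \<subseteq> X" using XI[of _ 0] by (simp only: scaleR_zero_left add_0_right) blast
    have xX: "(x, r) \<in> X" using XI[OF zT, of 1] by simp
    have XF: "X \<notin> \<F>" using max[OF _ TX] xX that by blast
    have Xadd: "p + q \<in> X" if pq: "p \<in> X" "q \<in> X" for p q
    proof -
      obtain p' c q' d where "p = p' + c *\<^sub>R (x, r)" "q = q' + d *\<^sub>R (x, r)" "p' \<in> T" "q' \<in> T" "0 \<le> c" "0 \<le> d"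
        using pq unfolding X_def by blast
      then have "p + q = (p' + q') + (c + d) *\<^sub>R (x, r)" "p' + q' \<in> T" "0 \<le> c + d"
        by (auto simp only: scaleR_add_left ac_simps Tadd add_nonneg_nonneg)
      then show ?thesis unfolding X_def by blast
    qed
    have Xscale: "c *\<^sub>R p \<in> X" if cp: "0 \<le> c" "p \<in> X" for c p
    proof -
      obtain p' d where "p = p' + d *\<^sub>R (x, r)" "p' \<in> T" "0 \<le> d"
        using cp unfolding X_def by blast
      then have "c *\<^sub>R p = c *\<^sub>R p' + (c * d) *\<^sub>R (x, r)" "c *\<^sub>R p' \<in> T" "0 \<le> c * d"
        using cp(1) by (simp_all only: scaleR_add_right scaleR_scaleR Tscale mult_nonneg_nonneg)
      then show ?thesis unfolding X_def by blast
    qed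
    have "\<exists>k. (0, k) \<in> X \<and> k < 0"
    proof (rule ccontr)
      assume "\<nexists>k. (0, k) \<in> X \<and> k < 0"
      then have Xpos: "0 \<le> k" if "(0, k) \<in> X" for k using that by force
      have "X \<in> \<F>" by (rule \<F>I[OF subset_trans[OF ST TX] Xadd Xscale Xpos])
      with XF show False ..
    qed
    then obtain k where k: "(0, k) \<in> X" "k < 0" by blast
    then obtain y u c where c: "(y, u) \<in> T" "0 \<le> c" "y + c *\<^sub>R x = 0" "u + c * r < 0"
      unfolding X_def by auto
    have "c \<noteq> 0" using c Tpos[of u] by auto
    then have "(1/c) *\<^sub>R (y, u) = (- x, u / c)" "u / c < - r"
      using c by (auto simp: add_eq_0_iff2 field_simps)
    moreover have "(1/c) *\<^sub>R (y, u) \<in> T" using c by (intro Tscale) auto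
    ultimately show ?thesis by auto
  qed
  define f where "f x = Inf {r. (x, r) \<in> T}" for x
  have ne: "{r. (x, r) \<in> T} \<noteq> {}" for x using dom[of x] ST by auto
  have bdd: "bdd_below {r. (x, r) \<in> T}" for x
  proof -
    obtain s where s: "(- x, s) \<in> T" using ne[of "- x"] by auto
    have "- s \<le> r" if "(x, r) \<in> T" for r
      using Tpos[of "s + r"] Tadd[OF s that] by simp
    then show ?thesis by (auto simp: bdd_below_def)
  qed
  have f_le: "f x \<le> r" if "(x, r) \<in> T" for x r
    unfolding f_def using that by (intro cInf_lower bdd) auto
  have f_ge: "s \<le> f x" if "\<And>r. (x, r) \<in> T \<Longrightarrow> s \<le> r" for x s
    unfolding f_def using that by (intro cInf_greatest ne) auto
  have near: "\<exists>r. (x, r) \<in> T \<and> r < f x + e" if "0 < e" for x e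
    using f_ge[of x "f x + e"] that by (metis add_le_same_cancel1 not_le)
  have sub: "f (x + y) \<le> f x + f y" for x y
  proof (rule field_le_epsilon)
    fix e :: real assume "0 < e"
    then obtain r s where "(x, r) \<in> T" "r < f x + e/2" "(y, s) \<in> T" "s < f y + e/2"
      using near[of "e/2"] by (meson half_gt_zero)
    then show "f (x + y) \<le> f x + f y + e" using f_le[of "x + y" "r + s"] Tadd[of "(x, r)" "(y, s)"] by simp
  qed
  \<comment> \<open>Maximality is used here: each r < f x has (x, r) outside T, so
    \<open>opposite\<close> bounds f (- x) by - r. An odd sublinear functional is linear.\<close>
  have odd: "f (- x) = - f x" for x
  proof (rule antisym)
    have "r \<le> - f (- x)" if "r < f x" for r
    proof -
      have "(x, r) \<notin> T" using f_le that by force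
      then obtain u where "(- x, u) \<in> T" "u < - r" using opposite by blast
      then show ?thesis using f_le[of "- x" u] by simp
    qed
    then show "f (- x) \<le> - f x" by (metis dense_le le_minus_iff)
    have "0 \<le> f 0" using f_ge[of 0 0] Tpos by blast
    then show "- f x \<le> f (- x)" using sub[of x "- x"] by simp
  qed
  have addf: "f (x + y) = f x + f y" for x y
    using sub[of x y] sub[of "- x" "- y"] odd[of "x + y"] odd[of x] odd[of y] by simp
  have scale_le: "f (c *\<^sub>R x) \<le> c * f x" if "0 < c" for c x
  proof -
    have "f (c *\<^sub>R x) / c \<le> f x"
    proof (rule f_ge)
      fix r assume "(x, r) \<in> T"
      then have "f (c *\<^sub>R x) \<le> c * r" using Tscale[of c "(x, r)"] that by (intro f_le) simp
      then show "f (c *\<^sub>R x) / c \<le> r" using that by (simp add: field_simps)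
    qed
    then show ?thesis using that by (simp add: field_simps)
  qed
  have scale_pos: "f (c *\<^sub>R x) = c * f x" if "0 < c" for c x
    using scale_le[OF that, of x] scale_le[of "1/c" "c *\<^sub>R x"] that by (simp add: field_simps)
  have f0: "f 0 = 0" using odd[of 0] by simp
  have "linear f"
  proof (rule linearI)
    show "f (c *\<^sub>R x) = c *\<^sub>R f x" for c x
    proof (cases c "0::real" rule: linorder_cases)
      case less
      then show ?thesis using scale_pos[of "- c" x] odd[of "c *\<^sub>R x"] by simp
    qed (use f0 scale_pos in auto)
  qed (rule addf)
  with that f_le ST show ?thesis by blast
qed

section \<open>Functionals as combinations of positive ones\<close>

definition positive_functional :: "'a::cstar_algebra cdual \<Rightarrow> bool" where
  "positive_functional \<psi> \<longleftrightarrow>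
     (\<forall>x. dual_apply \<psi> (adj x * x) \<in> \<real> \<and> 0 \<le> Re (dual_apply \<psi> (adj x * x)))"

definition hermitian_functional :: "'a::cstar_algebra cdual \<Rightarrow> bool" where
  "hermitian_functional \<phi> \<longleftrightarrow> (\<forall>x. dual_apply \<phi> (adj x) = cnj (dual_apply \<phi> x))"

lemma dual_apply_scaleR: "dual_apply \<phi> (r *\<^sub>R x) = of_real r * dual_apply \<phi> x"
  by (simp add: scaleR_scaleC dual_apply_scaleC)

lemma dual_apply_zero [simp]: "dual_apply \<phi> 0 = 0"
  using dual_apply_scaleR[of \<phi> 0 0] by simp

lemma dual_apply_minus: "dual_apply \<phi> (- x) = - dual_apply \<phi> x"
  using dual_apply_scaleR[of \<phi> "-1" x] by simp

lemma dual_apply_diff: "dual_apply \<phi> (x - y) = dual_apply \<phi> x - dual_apply \<phi> y"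
  using dual_apply_add[of \<phi> x "- y"] by (simp add: dual_apply_minus)

definition re_part :: "'a::cstar_algebra \<Rightarrow> 'a" where
  "re_part x = (1/2) *\<^sub>R (x + adj x)"

lemma re_part_add: "re_part (x + y) = re_part x + re_part y"
  by (simp add: re_part_def adj_add algebra_simps)

lemma re_part_scaleR: "re_part (r *\<^sub>R x) = r *\<^sub>R re_part x"
  by (simp add: re_part_def adj_scaleR algebra_simps)

lemma re_part_minus: "re_part (- x) = - re_part x"
  by (simp add: re_part_def adj_minus algebra_simps)

lemma adj_re_part: "adj (re_part x) = re_part x"
  by (simp add: re_part_def adj_add adj_adj adj_scaleR add.commute)

lemma re_part_sa: "adj x = x \<Longrightarrow> re_part x = x"
  by (simp add: re_part_def flip: scaleR_2)

lemma norm_re_part: "norm (re_part x) \<le> norm x"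
  using norm_triangle_ineq[of x "adj x"] by (simp add: re_part_def norm_adj)

text \<open>Jordan decomposition in the form \<phi> = \<psi> - (\<psi> - \<phi>): a bounded real
  functional f is sought that lies above both 0 and Re \<phi> on the cone.\<close>

lemma hermitian_dominated_by_positive:
  fixes \<phi> :: "'a::cstar_algebra cdual"
  assumes "hermitian_functional \<phi>"
  obtains \<psi> where "positive_functional \<psi>" "positive_functional (\<psi> - \<phi>)"
proof -
  let ?C = "norm \<phi>"
  \<comment> \<open>The pairs (x, C t - Re \<phi>(b)) with t >= 0, b >= 0 and Re x + b <= t. Taking
    t = 0 at x = -b encodes the two lower bounds on f, b = 0 with t = norm x its boundedness. The
    condition at 0 holds because 0 <= b <= t forces norm b <= t.\<close>
  define S where "S = {(x, ?C * t - Re (dual_apply \<phi> b)) |x t b.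
    0 \<le> t \<and> cpos b \<and> cpos (t *\<^sub>R 1 - b - re_part x)}"
  have SI: "(x, r) \<in> S" if "0 \<le> t" "cpos b" "cpos (t *\<^sub>R 1 - b - re_part x)" "r = ?C * t - Re (dual_apply \<phi> b)" for x r t b
    using that unfolding S_def by blast
  obtain f where f: "linear f" "\<And>x r. (x, r) \<in> S \<Longrightarrow> f x \<le> r"
  proof (rule linear_below_cone[of S])
    fix p q assume "p \<in> S" "q \<in> S"
    then obtain x t b y s c where *: "p = (x, ?C * t - Re (dual_apply \<phi> b))" "q = (y, ?C * s - Re (dual_apply \<phi> c))"
      "0 \<le> t" "cpos b" "cpos (t *\<^sub>R 1 - b - re_part x)" "0 \<le> s" "cpos c" "cpos (s *\<^sub>R 1 - c - re_part y)"
      unfolding S_def by blast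
    have "(t + s) *\<^sub>R 1 - (b + c) - re_part (x + y) = (t *\<^sub>R 1 - b - re_part x) + (s *\<^sub>R 1 - c - re_part y)"
      by (simp add: re_part_add algebra_simps)
    then have "cpos ((t + s) *\<^sub>R 1 - (b + c) - re_part (x + y))" using * cpos_add by metis
    moreover have "p + q = (x + y, ?C * (t + s) - Re (dual_apply \<phi> (b + c)))"
      using * by (simp add: dual_apply_add algebra_simps)
    ultimately show "p + q \<in> S" using * SI[of "t + s" "b + c" "x + y"] by (simp add: cpos_add)
  next
    fix k p assume k: "0 \<le> (k::real)" and "p \<in> S"
    then obtain x t b where *: "p = (x, ?C * t - Re (dual_apply \<phi> b))"
      "0 \<le> t" "cpos b" "cpos (t *\<^sub>R 1 - b - re_part x)"
      unfolding S_def by blast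
    have "(k * t) *\<^sub>R 1 - k *\<^sub>R b - re_part (k *\<^sub>R x) = k *\<^sub>R (t *\<^sub>R 1 - b - re_part x)"
      by (simp add: re_part_scaleR algebra_simps)
    then have "cpos ((k * t) *\<^sub>R 1 - k *\<^sub>R b - re_part (k *\<^sub>R x))" using * k cpos_scaleR by metis
    moreover have "k *\<^sub>R p = (k *\<^sub>R x, ?C * (k * t) - Re (dual_apply \<phi> (k *\<^sub>R b)))"
      using * by (simp add: dual_apply_scaleR algebra_simps)
    ultimately show "k *\<^sub>R p \<in> S" using * k SI[of "k * t" "k *\<^sub>R b" "k *\<^sub>R x"] by (simp add: cpos_scaleR)
  next
    fix x
    have "(x, ?C * norm x - Re (dual_apply \<phi> 0)) \<in> S"
      by (rule SI[of "norm x" 0]) (auto intro: cpos_one_minus adj_re_part norm_re_part)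
    then show "\<exists>r. (x, r) \<in> S" by blast
  next
    fix r assume "(0, r) \<in> S"
    then obtain t b where *: "r = ?C * t - Re (dual_apply \<phi> b)" "0 \<le> t" "cpos b" "cpos (t *\<^sub>R 1 - b)"
      unfolding S_def by (auto simp: re_part_def)
    have "Re (dual_apply \<phi> b) \<le> ?C * norm b"
      using norm_dual_apply[of \<phi> b] complex_Re_le_cmod order_trans by blast
    also have "\<dots> \<le> ?C * t" using * by (intro mult_left_mono norm_le_of_cpos) auto
    finally show "0 \<le> r" using * by simp
  qed blast
  have f_pos: "0 \<le> f b" "Re (dual_apply \<phi> b) \<le> f b" if "cpos b" for b
  proof -
    have re: "re_part (- b) = - b" using that by (simp add: re_part_minus re_part_sa cpos_sa)
    have "(- b, 0) \<in> S" by (rule SI[of 0 0]) (simp_all add: re that)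
    then show "0 \<le> f b" using f(2)[of "- b" 0] linear_neg[OF f(1), of b] by simp
    have "(- b, - Re (dual_apply \<phi> b)) \<in> S" by (rule SI[of 0 b]) (simp_all add: re that)
    then show "Re (dual_apply \<phi> b) \<le> f b" using f(2)[of "- b"] linear_neg[OF f(1), of b] by fastforce
  qed
  \<comment> \<open>\<open>S\<close> sees x only through its real part, so f kills skew-adjoint
    elements; this makes the complexification real on self-adjoint ones.\<close>
  have f_skew: "f x = 0" if "re_part x = 0" for x
  proof -
    have "(y, 0) \<in> S" if "re_part y = 0" for y by (rule SI[of 0 0]) (simp_all add: that)
    then have "f x \<le> 0" "f (- x) \<le> 0" using f(2) that by (auto simp: re_part_minus)
    then show ?thesis using linear_neg[OF f(1), of x] by simp
  qed
  have f_bound: "\<bar>f x\<bar> \<le> ?C * norm x" for x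
  proof -
    have "f y \<le> ?C * norm y" for y
    proof -
      have "(y, ?C * norm y) \<in> S"
        by (rule SI[of "norm y" 0]) (auto intro: cpos_one_minus adj_re_part norm_re_part)
      then show ?thesis by (rule f(2))
    qed
    from this[of x] this[of "- x"] show ?thesis using linear_neg[OF f(1), of x] by simp
  qed
  \<comment> \<open>The complex-linear functional x \<mapsto> f(x) - i f(i x) with real part
    f.\<close>
  define g where "g x = Complex (f x) (- f (\<i> *\<^sub>C x))" for x
  have g_add: "g (x + y) = g x + g y" for x y
    by (simp add: g_def complex_eq_iff linear_add[OF f(1)] scaleC_add_right)
  have decomp: "c *\<^sub>C x = Re c *\<^sub>R x + Im c *\<^sub>R (\<i> *\<^sub>C x)" for c and x :: 'a
    by (simp add: scaleR_scaleC scaleC_scaleC scaleC_add_left[symmetric] mult.commute flip: complex_eq)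
  have ii: "\<i> *\<^sub>C \<i> *\<^sub>C x = - x" for x :: 'a
    using scaleC_minus_left[of 1 x] by (simp add: scaleC_scaleC)
  have icx: "\<i> *\<^sub>C c *\<^sub>C x = Re c *\<^sub>R (\<i> *\<^sub>C x) - Im c *\<^sub>R x" for c and x :: 'a
    unfolding decomp[of c x] scaleC_add_right
    by (simp add: scaleR_scaleC scaleC_scaleC scaleC_minus_left[symmetric] diff_conv_add_uminus mult.commute)
  have g_scale: "g (c *\<^sub>C x) = c * g x" for c x
  proof -
    have "f (\<i> *\<^sub>C c *\<^sub>C x) = Re c * f (\<i> *\<^sub>C x) - Im c * f x"
      unfolding icx using f(1) by (simp add: linear_diff linear_scale)
    moreover have "f (c *\<^sub>C x) = Re c * f x + Im c * f (\<i> *\<^sub>C x)"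
      unfolding decomp[of c x] using f(1) by (simp add: linear_add linear_scale)
    ultimately show ?thesis by (simp add: g_def complex_eq_iff)
  qed
  define \<psi> where "\<psi> = Dual g"
  have \<psi>: "dual_apply \<psi> = g" unfolding \<psi>_def
  proof (rule dual_apply_Dual[where K = "2 * ?C"])
    show "norm (g x) \<le> norm x * (2 * ?C)" for x
      using cmod_le[of "g x"] f_bound[of x] f_bound[of "\<i> *\<^sub>C x"]
      by (simp add: g_def norm_scaleC mult_ac)
  qed (simp_all add: g_add g_scale)
  have g_sa: "g b = of_real (f b)" if "adj b = b" for b
    using f_skew[of "\<i> *\<^sub>C b"] that
    by (simp add: g_def complex_eq_iff re_part_def adj_scaleC scaleC_minus_left)
  have \<phi>_sa: "dual_apply \<phi> b \<in> \<real>" if "adj b = b" for b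
    using assms that unfolding hermitian_functional_def by (metis Reals_cnj_iff)
  have sa: "adj (adj x * x) = adj x * x" for x :: 'a by (simp add: adj_mult adj_adj)
  show ?thesis
  proof (rule that[of \<psi>])
    show "positive_functional \<psi>" unfolding positive_functional_def \<psi>
      using f_pos[OF cpos_adj_mult] by (simp add: g_sa[OF sa])
    show "positive_functional (\<psi> - \<phi>)" unfolding positive_functional_def
      using f_pos[OF cpos_adj_mult] \<phi>_sa[OF sa] by (simp add: \<psi> g_sa[OF sa])
  qed
qed

lemma positive_decomposition:
  fixes \<phi> :: "'a::cstar_algebra cdual"
  obtains \<psi>\<^sub>1 \<psi>\<^sub>2 \<psi>\<^sub>3 \<psi>\<^sub>4 where
    "positive_functional \<psi>\<^sub>1" "positive_functional \<psi>\<^sub>2" "positive_functional \<psi>\<^sub>3" "positive_functional \<psi>\<^sub>4"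
    "\<phi> = (\<psi>\<^sub>1 - \<psi>\<^sub>2) + \<i> *\<^sub>C (\<psi>\<^sub>3 - \<psi>\<^sub>4)"
proof -
  define \<alpha> where "\<alpha> = (1/2) *\<^sub>C (\<phi> + dual_adj \<phi>)"
  define \<beta> where "\<beta> = (- \<i>/2) *\<^sub>C (\<phi> - dual_adj \<phi>)"
  have "hermitian_functional \<alpha>"
    by (simp add: hermitian_functional_def \<alpha>_def adj_adj add.commute)
  then obtain \<psi>\<^sub>1 where 1: "positive_functional \<psi>\<^sub>1" "positive_functional (\<psi>\<^sub>1 - \<alpha>)"
    by (rule hermitian_dominated_by_positive)
  have "hermitian_functional \<beta>"
    by (simp add: hermitian_functional_def \<beta>_def adj_adj algebra_simps)
  then obtain \<psi>\<^sub>3 where 3: "positive_functional \<psi>\<^sub>3" "positive_functional (\<psi>\<^sub>3 - \<beta>)"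
    by (rule hermitian_dominated_by_positive)
  have "\<phi> = (\<psi>\<^sub>1 - (\<psi>\<^sub>1 - \<alpha>)) + \<i> *\<^sub>C (\<psi>\<^sub>3 - (\<psi>\<^sub>3 - \<beta>))"
    by (rule dual_eqI) (simp add: \<alpha>_def \<beta>_def field_simps)
  with 1 3 that show ?thesis by blast
qed

section \<open>Positive functionals on the bidual\<close>

text \<open>A discriminant argument: rotating c so that c D = t |D| leaves a quadratic inequality in
  t, and t = b/a is optimal. The degenerate cases a = 0 and b = 0 need their own t. It serves
  Cauchy-Schwarz and the approximate Riesz representation alike.\<close>

lemma norm_le_mult_of_quadratic:
  fixes D :: complex
  assumes "0 \<le> a" "0 \<le> b" and bound: "\<And>c. Re (c * D) \<le> ((norm c)\<^sup>2 * a\<^sup>2 + b\<^sup>2) / 2"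
  shows "norm D \<le> a * b"
proof (cases "D = 0")
  case False
  have t: "t * norm D \<le> (t\<^sup>2 * a\<^sup>2 + b\<^sup>2) / 2" for t
  proof -
    have "cnj D * D = of_real ((norm D)\<^sup>2)" by (metis complex_norm_square mult.commute)
    then have "of_real (t / norm D) * cnj D * D = of_real (t * norm D)"
      using False by (simp add: mult.assoc power2_eq_square)
    then have "Re (of_real (t / norm D) * cnj D * D) = t * norm D" by simp
    moreover have "norm (of_real (t / norm D) * cnj D) = \<bar>t\<bar>"
      using False by (simp add: norm_mult norm_divide)
    ultimately show ?thesis using bound[of "of_real (t / norm D) * cnj D"] by simp
  qed
  show ?thesis
  proof (cases "a = 0")
    case True
    then show ?thesis using t[of "(b\<^sup>2 + 1) / norm D"] False zero_le_power2[of b] by simp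
  next
    case a: False
    show ?thesis
    proof (cases "b = 0")
      case True
      have "(norm D / a\<^sup>2) * norm D \<le> ((norm D / a\<^sup>2) * norm D) / 2"
        using t[of "norm D / a\<^sup>2"] a True by (simp add: power2_eq_square)
      then have "(norm D / a\<^sup>2) * norm D \<le> 0" by simp
      moreover have "(norm D / a\<^sup>2) * norm D > 0" using a False by simp
      ultimately show ?thesis by simp
    next
      case False
      then have "(b / a) * norm D \<le> b\<^sup>2" using t[of "b / a"] a by (simp add: power_divide)
      then show ?thesis using a False assms by (simp add: field_simps power2_eq_square)
    qed
  qed
qed (use assms in simp)

lemma nonpos_of_le_small:
  fixes a A B :: real
  assumes "\<And>t. 0 < t \<Longrightarrow> a \<le> t * (A + t * B)"
  shows "a \<le> 0"
proof (rule tendsto_lowerbound)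
  show "((\<lambda>t. t * (A + t * B)) \<longlongrightarrow> 0) (at_right 0)"
    by (auto intro!: tendsto_eq_intros)
  show "\<forall>\<^sub>F t in at_right 0. a \<le> t * (A + t * B)"
    using assms by (auto simp: eventually_at_filter)
qed simp

lemma positive_functional_add:
  "positive_functional \<phi> \<Longrightarrow> positive_functional \<psi> \<Longrightarrow> positive_functional (\<phi> + \<psi>)"
  by (auto simp: positive_functional_def)

lemma positive_functional_scale:
  "positive_functional \<phi> \<Longrightarrow> 0 \<le> r \<Longrightarrow> positive_functional (of_real r *\<^sub>C \<phi>)"
  by (auto simp: positive_functional_def)

lemma positive_imp_hermitian:
  fixes \<psi> :: "'a::cstar_algebra cdual"
  assumes "positive_functional \<psi>" shows "hermitian_functional \<psi>"
  unfolding hermitian_functional_def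
proof
  fix x
  have im: "Im (dual_apply \<psi> (adj y * y)) = 0" for y
    using assms by (simp add: positive_functional_def complex_is_Real_iff)
  have "adj (1 + y) * (1 + y) = adj 1 * 1 + y + adj y + adj y * y" for y :: 'a
    by (simp add: adj_add algebra_simps)
  then have "Im (dual_apply \<psi> y) + Im (dual_apply \<psi> (adj y)) = 0" for y
    using im[of "1 + y"] im[of 1] im[of y] by (simp add: dual_apply_add)
  from this[of x] this[of "\<i> *\<^sub>C x"]
  show "dual_apply \<psi> (adj x) = cnj (dual_apply \<psi> x)"
    by (simp add: complex_eq_iff adj_scaleC dual_apply_scaleC)
qed

section \<open>Cauchy-Schwarz and approximate GNS vectors\<close>

definition gns_norm :: "'a::cstar_algebra cdual \<Rightarrow> 'a \<Rightarrow> real" where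
  "gns_norm \<psi> x = sqrt (Re (dual_apply \<psi> (adj x * x)))"

context
  fixes \<psi> :: "'a::cstar_algebra cdual"
  assumes pos: "positive_functional \<psi>"
begin

lemma gns_norm_nonneg: "0 \<le> gns_norm \<psi> x"
  using pos by (simp add: gns_norm_def positive_functional_def)

lemma gns_norm_square: "dual_apply \<psi> (adj x * x) = of_real ((gns_norm \<psi> x)\<^sup>2)"
  using pos by (simp add: gns_norm_def positive_functional_def complex_eq_iff complex_is_Real_iff)

lemma gns_norm_le: "gns_norm \<psi> x \<le> sqrt (norm \<psi>) * norm x"
proof -
  have "Re (dual_apply \<psi> (adj x * x)) \<le> norm \<psi> * norm (adj x * x)"
    using norm_dual_apply complex_Re_le_cmod order_trans by blast
  then have "gns_norm \<psi> x \<le> sqrt (norm \<psi> * (norm x)\<^sup>2)"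
    by (simp add: gns_norm_def cstar_identity)
  then show ?thesis by (simp add: real_sqrt_mult)
qed

lemma gns_norm_scaleC: "gns_norm \<psi> (c *\<^sub>C x) = norm c * gns_norm \<psi> x"
proof -
  have "adj (c *\<^sub>C x) * (c *\<^sub>C x) = (norm c)\<^sup>2 *\<^sub>R (adj x * x)"
    by (simp only: adj_scaleC scaleC_mult_left scaleC_mult_right scaleC_scaleC scaleR_scaleC
        complex_norm_square mult.commute[of c])
  then show ?thesis by (simp add: gns_norm_def dual_apply_scaleR real_sqrt_mult)
qed

lemma gns_norm_add:
  "(gns_norm \<psi> (x + y))\<^sup>2 = (gns_norm \<psi> x)\<^sup>2 + 2 * Re (dual_apply \<psi> (adj x * y)) + (gns_norm \<psi> y)\<^sup>2"
proof -
  have "dual_apply \<psi> (adj y * x) = cnj (dual_apply \<psi> (adj x * y))"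
    using positive_imp_hermitian[OF pos] unfolding hermitian_functional_def
    by (metis adj_adj adj_mult)
  moreover have "(gns_norm \<psi> z)\<^sup>2 = Re (dual_apply \<psi> (adj z * z))" for z
    by (simp add: gns_norm_square)
  ultimately show ?thesis by (simp add: adj_add distrib_left distrib_right dual_apply_add)
qed

lemma functional_cauchy_schwarz:
  "norm (dual_apply \<psi> (adj y * x)) \<le> gns_norm \<psi> x * gns_norm \<psi> y"
proof (rule norm_le_mult_of_quadratic)
  fix c
  have "0 \<le> (gns_norm \<psi> (y + (- c) *\<^sub>C x))\<^sup>2" by simp
  then show "Re (c * dual_apply \<psi> (adj y * x)) \<le> ((norm c)\<^sup>2 * (gns_norm \<psi> x)\<^sup>2 + (gns_norm \<psi> y)\<^sup>2) / 2"
    unfolding gns_norm_add gns_norm_scaleC scaleC_mult_right dual_apply_scaleC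
    by (simp add: power_mult_distrib)
qed (rule gns_norm_nonneg)+

text \<open>An exact minimiser of Q in the completed GNS space would represent f. If Q w is within
  e^2 of the infimum, comparing w with w + c x gives a quadratic bound on the defect whose constant
  term is e^2; Q is bounded below by -L^2.\<close>

lemma approximate_riesz:
  fixes f :: "'a cdual"
  assumes f: "\<And>x. norm (dual_apply f x) \<le> L * gns_norm \<psi> x" and e: "0 < e"
  shows "\<exists>w. \<forall>x. norm (dual_apply f x - dual_apply \<psi> (adj w * x)) \<le> gns_norm \<psi> x * e"
proof -
  define Q where "Q x = (gns_norm \<psi> x)\<^sup>2 - 2 * Re (dual_apply f x)" for x
  have "- (L\<^sup>2) \<le> Q x" for x
  proof -
    have "Re (dual_apply f x) \<le> L * gns_norm \<psi> x"
      using f complex_Re_le_cmod order_trans by blast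
    moreover have "0 \<le> (gns_norm \<psi> x - L)\<^sup>2" by simp
    ultimately show ?thesis by (simp add: Q_def power2_eq_square algebra_simps)
  qed
  then have bdd: "bdd_below (range Q)" by (auto simp: bdd_below_def)
  obtain w where w: "Q w < Inf (range Q) + e\<^sup>2"
    using cInf_lessD[of "range Q" "Inf (range Q) + e\<^sup>2"] e by auto
  have "norm (dual_apply f x - dual_apply \<psi> (adj w * x)) \<le> gns_norm \<psi> x * e" for x
  proof (rule norm_le_mult_of_quadratic)
    fix c
    have "Q w - e\<^sup>2 \<le> Q (w + c *\<^sub>C x)" using w cInf_lower[OF _ bdd, of "Q (w + c *\<^sub>C x)"] by auto
    then show "Re (c * (dual_apply f x - dual_apply \<psi> (adj w * x))) \<le> ((norm c)\<^sup>2 * (gns_norm \<psi> x)\<^sup>2 + e\<^sup>2) / 2"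
      unfolding Q_def gns_norm_add gns_norm_scaleC scaleC_mult_right dual_apply_add dual_apply_scaleC
      by (simp add: power_mult_distrib algebra_simps)
  qed (use e gns_norm_nonneg in auto)
  then show ?thesis by blast
qed

text \<open>Formally \<open>(H\<^sup>* H)(\<psi>) = \<parallel>\<xi>\<parallel>\<^sup>2\<close> with \<open>\<xi>\<close> the vector of the GNS space of \<open>\<psi>\<close> representing the
  functional \<open>x \<mapsto> \<psi>(H\<^sup>* x)\<close>; \<open>w\<close> below approximates \<open>\<xi>\<close>, which spares us the completion.\<close>

lemma bidual_positive:
  "dual_apply (bidual_adj H \<odot> H) \<psi> \<in> \<real> \<and> 0 \<le> Re (dual_apply (bidual_adj H \<odot> H) \<psi>)"
proof -
  define K where "K = sqrt (norm \<psi>)"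
  define L where "L = norm H * K"
  define f where "f = dual_adj (bidual_act H \<psi>)"
  define Z where "Z = dual_apply H f"
  have K: "0 \<le> K" by (simp add: K_def)
  have val: "dual_apply (bidual_adj H \<odot> H) \<psi> = cnj Z" by (simp add: Z_def f_def)
  have fx: "norm (dual_apply f x) \<le> L * gns_norm \<psi> x" for x
  proof -
    have "norm (dual_times \<psi> (adj x)) \<le> K * gns_norm \<psi> x"
    proof (rule norm_dual_le)
      fix y
      have "norm (dual_apply \<psi> (adj x * y)) \<le> gns_norm \<psi> y * gns_norm \<psi> x"
        by (rule functional_cauchy_schwarz)
      also have "\<dots> \<le> (K * norm y) * gns_norm \<psi> x"
        unfolding K_def by (intro mult_right_mono gns_norm_le gns_norm_nonneg)
      finally show "norm (dual_apply (dual_times \<psi> (adj x)) y) \<le> K * gns_norm \<psi> x * norm y"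
        by (simp add: mult_ac)
    qed (simp add: K gns_norm_nonneg)
    then have "norm H * norm (dual_times \<psi> (adj x)) \<le> L * gns_norm \<psi> x"
      unfolding L_def mult.assoc by (intro mult_left_mono) auto
    then show ?thesis using norm_dual_apply[of H "dual_times \<psi> (adj x)"] by (simp add: f_def)
  qed
  \<comment> \<open>Z is close to the squared GNS norm of w: f is norm-close to \<psi>(w* .), where
    H takes the value cnj (f w), and f w is close to \<psi>(w* w). The uniform bound L + e on the
    GNS norm of w keeps both errors of order e.\<close>
  have approx: "\<exists>s\<ge>0. norm (Z - of_real s) \<le> e * ((norm H * K + L) + e * 1)" if e: "0 < e" for e
  proof -
    obtain w where w: "\<And>x. norm (dual_apply f x - dual_apply \<psi> (adj w * x)) \<le> gns_norm \<psi> x * e"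
      using approximate_riesz[OF fx e] by blast
    let ?s = "gns_norm \<psi> w"
    have fw: "norm (dual_apply f w - of_real (?s\<^sup>2)) \<le> ?s * e"
      using w[of w] by (simp only: gns_norm_square)
    have "?s\<^sup>2 \<le> norm (dual_apply f w) + ?s * e"
      using fw norm_triangle_sub[of "of_real (?s\<^sup>2)" "dual_apply f w"]
      by (simp add: norm_minus_commute norm_power)
    with fx[of w] have "?s * ?s \<le> ?s * (L + e)" by (simp add: power2_eq_square algebra_simps)
    then have s: "?s \<le> L + e"
    proof (cases "?s = 0")
      case True
      then show ?thesis using e K by (simp add: L_def)
    qed (use gns_norm_nonneg[of w] in \<open>simp add: mult_le_cancel_left\<close>)
    have "norm (f - dual_times \<psi> (adj w)) \<le> K * e"
    proof (rule norm_dual_le)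
      fix x
      have "norm (dual_apply f x - dual_apply \<psi> (adj w * x)) \<le> gns_norm \<psi> x * e" by (rule w)
      also have "\<dots> \<le> (K * norm x) * e" using e unfolding K_def by (intro mult_right_mono gns_norm_le) auto
      finally show "norm (dual_apply (f - dual_times \<psi> (adj w)) x) \<le> K * e * norm x" by (simp add: mult_ac)
    qed (use e K in simp)
    then have "norm (dual_apply H (f - dual_times \<psi> (adj w))) \<le> norm H * (K * e)"
      using norm_dual_apply[of H "f - dual_times \<psi> (adj w)"] by (meson mult_left_mono norm_ge_zero order_trans)
    moreover have "dual_apply H (f - dual_times \<psi> (adj w)) = Z - cnj (dual_apply f w)"
      unfolding dual_apply_diff by (simp add: Z_def f_def)
    moreover have "norm (cnj (dual_apply f w) - of_real (?s\<^sup>2)) \<le> (L + e) * e"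
    proof -
      have "cnj (dual_apply f w) - of_real (?s\<^sup>2) = cnj (dual_apply f w - of_real (?s\<^sup>2))" by simp
      then have "norm (cnj (dual_apply f w) - of_real (?s\<^sup>2)) \<le> ?s * e" using fw by (metis complex_mod_cnj)
      also have "\<dots> \<le> (L + e) * e" using s e by (intro mult_right_mono) auto
      finally show ?thesis .
    qed
    ultimately have "norm (Z - of_real (?s\<^sup>2)) \<le> norm H * (K * e) + (L + e) * e"
      using norm_triangle_mono[of "Z - cnj (dual_apply f w)" _ "cnj (dual_apply f w) - of_real (?s\<^sup>2)"] by fastforce
    then show ?thesis by (intro exI[of _ "?s\<^sup>2"]) (simp add: algebra_simps)
  qed
  have "\<bar>Im Z\<bar> \<le> 0"
  proof (rule nonpos_of_le_small)
    fix e :: real assume "0 < e"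
    then obtain s where "norm (Z - of_real s) \<le> e * ((norm H * K + L) + e * 1)" using approx by blast
    then show "\<bar>Im Z\<bar> \<le> e * ((norm H * K + L) + e * 1)" using abs_Im_le_cmod[of "Z - of_real s"] by simp
  qed
  moreover have "- Re Z \<le> 0"
  proof (rule nonpos_of_le_small)
    fix e :: real assume "0 < e"
    then obtain s where "0 \<le> s" "norm (Z - of_real s) \<le> e * ((norm H * K + L) + e * 1)" using approx by blast
    then show "- Re Z \<le> e * ((norm H * K + L) + e * 1)" using abs_Re_le_cmod[of "Z - of_real s"] by simp
  qed
  ultimately show ?thesis unfolding val complex_is_Real_iff by simp
qed

end

section \<open>The Arens product and cutting by central projections\<close>

lemma bidual_act_add_left: "bidual_act (F + G) \<phi> = bidual_act F \<phi> + bidual_act G \<phi>"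
  by (rule dual_eqI) simp

lemma bidual_act_diff_left: "bidual_act (F - G) \<phi> = bidual_act F \<phi> - bidual_act G \<phi>"
  by (rule dual_eqI) simp

lemma bidual_act_scaleC_left: "bidual_act (c *\<^sub>C F) \<phi> = c *\<^sub>C bidual_act F \<phi>"
  by (rule dual_eqI) simp

lemma arens_add_left: "(F + G) \<odot> H = F \<odot> H + G \<odot> H"
  by (rule dual_eqI) simp

lemma arens_add_right: "H \<odot> (F + G) = H \<odot> F + H \<odot> G"
  by (rule dual_eqI) (simp only: arens_apply bidual_act_add_left dual_apply_add dual_apply_plus_fun)

lemma arens_diff_left: "(F - G) \<odot> H = F \<odot> H - G \<odot> H"
  by (rule dual_eqI) simp

lemma arens_diff_right: "H \<odot> (F - G) = H \<odot> F - H \<odot> G"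
  by (rule dual_eqI) (simp only: arens_apply bidual_act_diff_left dual_apply_diff dual_apply_minus_fun)

lemma arens_scaleC_left: "(c *\<^sub>C F) \<odot> H = c *\<^sub>C (F \<odot> H)"
  by (rule dual_eqI) simp

lemma arens_scaleC_right: "H \<odot> (c *\<^sub>C F) = c *\<^sub>C (H \<odot> F)"
  by (rule dual_eqI) (simp only: arens_apply bidual_act_scaleC_left dual_apply_scaleC dual_apply_scaleC_fun)

lemma bidual_act_arens: "bidual_act (F \<odot> G) \<phi> = bidual_act F (bidual_act G \<phi>)"
proof (rule dual_eqI)
  fix x
  have "bidual_act G (dual_times \<phi> x) = dual_times (bidual_act G \<phi>) x"
  proof (rule dual_eqI)
    fix y
    have "dual_times (dual_times \<phi> x) y = dual_times \<phi> (x * y)"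
      by (rule dual_eqI) (simp add: mult.assoc)
    then show "dual_apply (bidual_act G (dual_times \<phi> x)) y = dual_apply (dual_times (bidual_act G \<phi>) x) y"
      by simp
  qed
  then show "dual_apply (bidual_act (F \<odot> G) \<phi>) x = dual_apply (bidual_act F (bidual_act G \<phi>)) x"
    by simp
qed

lemma arens_assoc: "(F \<odot> G) \<odot> H = F \<odot> (G \<odot> H)"
  by (rule dual_eqI) (simp add: bidual_act_arens)

lemma bidual_adj_add: "bidual_adj (F + G) = bidual_adj F + bidual_adj G"
  by (rule dual_eqI) simp

lemma bidual_adj_diff: "bidual_adj (F - G) = bidual_adj F - bidual_adj G"
  by (rule dual_eqI) simp

lemma bidual_adj_scaleC: "bidual_adj (c *\<^sub>C F) = cnj c *\<^sub>C bidual_adj F"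
  by (rule dual_eqI) simp

lemma bidual_projection_compl:
  "bidual_projection r \<Longrightarrow> bidual_projection (canonical 1 - r)"
  by (simp add: bidual_projection_def arens_diff_left arens_diff_right canonical_one_left
      canonical_one_right bidual_adj_diff flip: canonical_adj)

lemma bidual_central_compl:
  "bidual_central r \<Longrightarrow> bidual_central (canonical 1 - r)"
  by (simp add: bidual_central_def arens_diff_left arens_diff_right canonical_one_left canonical_one_right)

lemma projection_apply_nonneg:
  assumes "positive_functional \<psi>" "bidual_projection r"
  shows "dual_apply r \<psi> \<in> \<real>" "0 \<le> Re (dual_apply r \<psi>)"
  using bidual_positive[OF assms(1), of r] assms(2) by (simp_all only: bidual_projection_def)

text \<open>The null case of Cauchy-Schwarz. Positivity of (r + c x)* (r + c x) at \<psi>, with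
  r(\<psi>) = 0, leaves a part real-linear in c plus a multiple of |c|^2; scaling c to 0 forces the
  first part to vanish.\<close>

lemma projection_null_mult:
  fixes \<psi> :: "'a::cstar_algebra cdual"
  assumes pos: "positive_functional \<psi>" and r: "bidual_projection r" and null: "dual_apply r \<psi> = 0"
  shows "dual_apply (r \<odot> canonical x) \<psi> = 0"
proof -
  define A where "A = dual_apply (canonical (adj x) \<odot> r) \<psi>"
  define B where "B = dual_apply (r \<odot> canonical x) \<psi>"
  define N where "N = dual_apply \<psi> (adj x * x)"
  have N: "Im N = 0"
    using pos by (simp add: N_def positive_functional_def complex_is_Real_iff)
  have val: "dual_apply (bidual_adj (r + c *\<^sub>C canonical x) \<odot> (r + c *\<^sub>C canonical x)) \<psi>
      = (c * B + cnj c * A) + of_real ((norm c)\<^sup>2) * N" for c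
  proof -
    have "bidual_adj (r + c *\<^sub>C canonical x) \<odot> (r + c *\<^sub>C canonical x)
      = r + c *\<^sub>C (r \<odot> canonical x) + cnj c *\<^sub>C (canonical (adj x) \<odot> r)
        + (cnj c * c) *\<^sub>C canonical (adj x * x)"
      using r by (simp add: bidual_projection_def bidual_adj_add bidual_adj_scaleC arens_add_left
          arens_add_right arens_scaleC_left arens_scaleC_right canonical_mult canonical_adj
          scaleC_add_right scaleC_scaleC add.assoc mult.commute)
    moreover have "cnj c * c = of_real ((norm c)\<^sup>2)"
      by (metis complex_norm_square mult.commute)
    ultimately show ?thesis
      by (simp add: A_def B_def N_def null del: arens_apply)
  qed
  note bp = bidual_positive[OF pos, of "r + c *\<^sub>C canonical x" for c, unfolded val]
  have im: "Im (c * B + cnj c * A) = 0" for c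
    using bp[of c] N by (simp add: complex_is_Real_iff)
  have re: "- Re (c * B + cnj c * A) \<le> 0" for c
  proof (rule nonpos_of_le_small)
    fix t :: real assume t: "0 < t"
    have "(of_real t * c) * B + cnj (of_real t * c) * A = of_real t * (c * B + cnj c * A)"
      by (simp add: algebra_simps)
    then have "0 \<le> t * Re (c * B + cnj c * A) + t\<^sup>2 * (norm c)\<^sup>2 * Re N"
      using bp[of "of_real t * c"] by (simp add: norm_mult power_mult_distrib)
    then have "0 \<le> t * (Re (c * B + cnj c * A) + t * ((norm c)\<^sup>2 * Re N))"
      by (simp add: power2_eq_square algebra_simps)
    then show "- Re (c * B + cnj c * A) \<le> t * ((norm c)\<^sup>2 * Re N + t * 0)"
      using t by (simp add: zero_le_mult_iff)
  qed
  have "c * B + cnj c * A = 0" for c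
    using re[of c] re[of "- c"] im[of c] by (simp add: complex_eq_iff)
  \<comment> \<open>c = 1 gives B + A = 0 and c = i gives B - A = 0.\<close>
  from this[of 1] this[of \<i>] have "B = 0" by (simp add: complex_eq_iff)
  then show ?thesis by (simp add: B_def)
qed

section \<open>The functionals \<phi>(F .)\<close>

lemma cut_add_left: "cut (F + G) \<phi> = cut F \<phi> + cut G \<phi>"
  by (rule dual_eqI) (simp add: cut_apply)

lemma cut_diff_left: "cut (F - G) \<phi> = cut F \<phi> - cut G \<phi>"
  by (rule dual_eqI) (simp add: cut_apply)

lemma cut_one: "cut (canonical 1) \<phi> = \<phi>"
  by (rule dual_eqI) (simp add: cut_apply)

lemma cut_add: "cut F (\<phi> + \<psi>) = cut F \<phi> + cut F \<psi>"
  by (rule dual_eqI) (simp only: cut_apply dual_apply_add dual_apply_plus_fun)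

lemma cut_diff: "cut F (\<phi> - \<psi>) = cut F \<phi> - cut F \<psi>"
  by (rule dual_eqI) (simp only: cut_apply dual_apply_diff dual_apply_minus_fun)

lemma cut_scaleC: "cut F (c *\<^sub>C \<phi>) = c *\<^sub>C cut F \<phi>"
  by (rule dual_eqI) (simp only: cut_apply dual_apply_scaleC dual_apply_scaleC_fun)

text \<open>Centrality moves G past the elements of M, so that the action of x on
  \<open>cut G \<phi>\<close> becomes the action of G x on \<phi>.\<close>

lemma cut_cut:
  assumes "bidual_central G" shows "cut F (cut G \<phi>) = cut (F \<odot> G) \<phi>"
proof (rule dual_eqI)
  fix x
  have "bidual_act (canonical x) (cut G \<phi>) = bidual_act (G \<odot> canonical x) \<phi>"
  proof (rule dual_eqI)
    fix y
    have "dual_apply (bidual_act (canonical x) (cut G \<phi>)) y = dual_apply (G \<odot> canonical y \<odot> canonical x) \<phi>"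
      by (simp add: cut_apply canonical_mult arens_assoc del: arens_apply)
    also have "G \<odot> canonical y \<odot> canonical x = canonical y \<odot> (G \<odot> canonical x)"
      using assms by (simp add: bidual_central_def arens_assoc)
    finally show "dual_apply (bidual_act (canonical x) (cut G \<phi>)) y = dual_apply (bidual_act (G \<odot> canonical x) \<phi>) y"
      by simp
  qed
  then show "dual_apply (cut F (cut G \<phi>)) x = dual_apply (cut (F \<odot> G) \<phi>) x"
    by (simp add: cut_apply bidual_act_arens)
qed

lemma apply_cut:
  assumes "bidual_central G" shows "dual_apply F (cut G \<phi>) = dual_apply (F \<odot> G) \<phi>"
proof -
  have "dual_apply F \<psi> = dual_apply (cut F \<psi>) 1" for F :: "'a bidual" and \<psi>
    by (simp add: cut_apply canonical_one_right del: arens_apply)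
  then show ?thesis using cut_cut[OF assms] by metis
qed

text \<open>As r is central, r x* x = x* r x, so the value is that of r at the positive functional y
  \<mapsto> \<psi>(x* y x).\<close>

lemma positive_functional_cut:
  fixes \<psi> :: "'a::cstar_algebra cdual"
  assumes pos: "positive_functional \<psi>" and r: "bidual_projection r" "bidual_central r"
  shows "positive_functional (cut r \<psi>)"
proof -
  have "dual_apply (cut r \<psi>) (adj x * x) \<in> \<real> \<and> 0 \<le> Re (dual_apply (cut r \<psi>) (adj x * x))" for x
  proof -
    define \<psi>\<^sub>x where "\<psi>\<^sub>x = bidual_act (canonical x) (dual_times \<psi> (adj x))"
    have "dual_apply \<psi>\<^sub>x (adj y * y) = dual_apply \<psi> (adj (y * x) * (y * x))" for y
      by (simp add: \<psi>\<^sub>x_def adj_mult mult.assoc)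
    then have "positive_functional \<psi>\<^sub>x" using pos by (simp only: positive_functional_def) blast
    from projection_apply_nonneg[OF this r(1)]
    have "dual_apply r \<psi>\<^sub>x \<in> \<real> \<and> 0 \<le> Re (dual_apply r \<psi>\<^sub>x)" by blast
    moreover have "dual_apply (cut r \<psi>) (adj x * x) = dual_apply r \<psi>\<^sub>x"
    proof -
      have "r \<odot> canonical (adj x * x) = canonical (adj x) \<odot> (r \<odot> canonical x)"
        using r(2) by (metis arens_assoc bidual_central_def canonical_mult)
      then show ?thesis by (simp add: cut_apply \<psi>\<^sub>x_def del: arens_apply) simp
    qed
    ultimately show ?thesis by simp
  qed
  then show ?thesis unfolding positive_functional_def by blast
qed

text \<open>On the singular part 1 - q is null by assumption. On the normal part q is null, being
  squeezed between 0 and 1 - z, which vanishes there. \<open>projection_null_mult\<close> carries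
  both facts over to products with x.\<close>

lemma positive_cut_by_dominated_projection:
  fixes \<psi> :: "'a::cstar_algebra cdual"
  assumes pos: "positive_functional \<psi>" and z: "bidual_projection z" "bidual_central z"
    and q: "bidual_projection q" "bidual_le q (canonical 1 - z)"
    and null: "dual_apply (canonical 1 - q) (cut (canonical 1 - z) \<psi>) = 0"
  shows "dual_apply (q \<odot> canonical x) \<psi> = dual_apply (cut (canonical 1 - z) \<psi>) x"
proof -
  define p where "p = canonical 1 - z"
  have p: "bidual_projection p" "bidual_central p"
    using z by (simp_all add: p_def bidual_projection_compl bidual_central_compl)
  have sing: "positive_functional (cut p \<psi>)" using positive_functional_cut[OF pos p] .
  have norm: "positive_functional (cut z \<psi>)" using positive_functional_cut[OF pos z] .
  have split: "\<psi> = cut p \<psi> + cut z \<psi>" by (simp add: p_def cut_one flip: cut_add_left)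
  have "dual_apply ((canonical 1 - q) \<odot> canonical x) (cut p \<psi>) = 0"
    using null by (intro projection_null_mult sing bidual_projection_compl q) (simp add: p_def)
  then have 1: "dual_apply (q \<odot> canonical x) (cut p \<psi>) = dual_apply (cut p \<psi>) x"
    by (simp add: arens_diff_left canonical_one_left del: arens_apply)
  obtain H where H: "p - q = bidual_adj H \<odot> H" using q(2) by (auto simp: bidual_le_def p_def)
  have "p \<odot> z = 0"
    using z(1) by (simp add: p_def bidual_projection_def arens_diff_left canonical_one_left)
  then have "dual_apply p (cut z \<psi>) = 0" by (simp add: apply_cut[OF z(2)])
  then have "Re (dual_apply q (cut z \<psi>)) \<le> 0"
    using bidual_positive[OF norm, of H] by (simp flip: H)
  then have "dual_apply q (cut z \<psi>) = 0"
    using projection_apply_nonneg[OF norm q(1)] by (simp add: complex_eq_iff complex_is_Real_iff)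
  then have 2: "dual_apply (q \<odot> canonical x) (cut z \<psi>) = 0"
    by (rule projection_null_mult[OF norm q(1)])
  have "dual_apply (q \<odot> canonical x) \<psi>
      = dual_apply (q \<odot> canonical x) (cut p \<psi>) + dual_apply (q \<odot> canonical x) (cut z \<psi>)"
    using split dual_apply_add by metis
  then show ?thesis using 1 2 by (simp add: p_def)
qed

section \<open>Peak projections\<close>

lemma weak_star_limit_apply:
  assumes "limitin weak_star_topology F l G"
  shows "((\<lambda>i. dual_apply (F i) x) \<longlongrightarrow> dual_apply l x) G"
proof -
  have "continuous_map weak_star_topology euclidean ((\<lambda>f. f x) \<circ> dual_apply)"
    unfolding weak_star_topology_def
    by (intro continuous_map_pullback continuous_map_product_projection) simp
  from continuous_map_limit[OF this assms] show ?thesis by (simp add: o_def)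
qed

text \<open>In q x the left factor is evaluated at a functional that depends only on x and \<phi>,
  so the weak* limit passes through.\<close>

lemma peak_projection_annihilates:
  fixes A :: "'a::cstar_algebra set"
  assumes A: "subalgebra A" and q: "peak_projection A q" and \<phi>: "\<phi> \<in> annihilator A" and x: "x \<in> A"
  shows "dual_apply (q \<odot> canonical x) \<phi> = 0"
proof -
  obtain a where a: "a \<in> A" "limitin weak_star_topology (\<lambda>n::nat. canonical (a ^ n)) q sequentially"
    using q by (auto simp: peak_projection_def)
  have "(\<lambda>n. dual_apply (canonical (a ^ n)) (bidual_act (canonical x) \<phi>))
      \<longlonglongrightarrow> dual_apply q (bidual_act (canonical x) \<phi>)"
    by (rule weak_star_limit_apply[OF a(2)])
  then have lim: "(\<lambda>n. dual_apply \<phi> (a ^ n * x)) \<longlonglongrightarrow> dual_apply (q \<odot> canonical x) \<phi>" by simp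
  \<comment> \<open>The factor x covers n = 0 as well, where a^0 = 1 may lie outside A.\<close>
  have "a ^ n * x \<in> A" for n
    using A a(1) x by (induction n) (auto simp: subalgebra_def mult.assoc)
  then have "dual_apply \<phi> (a ^ n * x) = 0" for n using \<phi> by (simp add: annihilator_def)
  with lim show ?thesis using LIMSEQ_unique[OF _ tendsto_const] by force
qed

text \<open>Serves functionals whose singular parts all vanish, where there is no state to
  normalise.\<close>

lemma peak_projection_zero:
  fixes A :: "'a::cstar_algebra set"
  assumes "subalgebra A" shows "peak_projection A 0"
proof -
  have "0 \<odot> 0 = (0 :: 'a bidual)" "bidual_adj 0 = (0 :: 'a bidual)"
    by (rule dual_eqI, simp)+
  moreover have "limitin weak_star_topology (\<lambda>n::nat. canonical ((0::'a) ^ n)) 0 sequentially"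
  proof (rule limitin_eventually)
    show "0 \<in> topspace (weak_star_topology :: 'a bidual topology)"
      by (simp add: weak_star_topology_def topspace_pullback_topology)
    have "canonical (0::'a) = 0" by (rule dual_eqI) simp
    \<comment> \<open>The sequence vanishes only from n = 1 on, since 0^0 = 1.\<close>
    then show "\<forall>\<^sub>F n::nat in sequentially. canonical ((0::'a) ^ n) = 0"
      by (intro eventually_sequentiallyI[of 1]) (simp add: power_0_left)
  qed
  ultimately show ?thesis
    using assms by (auto simp: peak_projection_def bidual_projection_def subalgebra_def intro!: bexI[of _ 0])
qed

theorem theorem5p5:
  fixes J :: "'a::cstar_algebra \<Rightarrow> 'p::complex_banach cdual"
    and z\<^sub>n :: "'a bidual" and A :: "'a set" and \<phi> :: "'a cdual"
  assumes "von_neumann_predual J"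
    and "is_normal_part_projection J z\<^sub>n"
    and "ueda_algebra J z\<^sub>n A"
    and "\<phi> \<in> annihilator A"
  shows "normal_part z\<^sub>n \<phi> \<in> annihilator A \<and> singular_part z\<^sub>n \<phi> \<in> annihilator A"
proof -
  define p where "p = canonical 1 - z\<^sub>n"
  have z: "bidual_projection z\<^sub>n" "bidual_central z\<^sub>n"
    using assms(2) by (simp_all add: is_normal_part_projection_def)
  then have p: "bidual_projection p" "bidual_central p"
    by (simp_all add: p_def bidual_projection_compl bidual_central_compl)
  have A: "subalgebra A" using assms(3) by (simp add: ueda_algebra_def)
  obtain \<psi>\<^sub>1 \<psi>\<^sub>2 \<psi>\<^sub>3 \<psi>\<^sub>4 where pos: "positive_functional \<psi>\<^sub>1" "positive_functional \<psi>\<^sub>2"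
      "positive_functional \<psi>\<^sub>3" "positive_functional \<psi>\<^sub>4"
    and \<phi>: "\<phi> = (\<psi>\<^sub>1 - \<psi>\<^sub>2) + \<i> *\<^sub>C (\<psi>\<^sub>3 - \<psi>\<^sub>4)"
    by (rule positive_decomposition)
  note pos_cut = pos[THEN positive_functional_cut[OF _ p]]
  define \<sigma> where "\<sigma> = cut p (\<psi>\<^sub>1 + \<psi>\<^sub>2 + \<psi>\<^sub>3 + \<psi>\<^sub>4)"
  have \<sigma>_sum: "\<sigma> = cut p \<psi>\<^sub>1 + cut p \<psi>\<^sub>2 + cut p \<psi>\<^sub>3 + cut p \<psi>\<^sub>4" by (simp add: \<sigma>_def cut_add)
  have \<sigma>_pos: "positive_functional \<sigma>"
    unfolding \<sigma>_sum by (intro positive_functional_add pos_cut)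
  obtain q where q: "peak_projection A q" "bidual_le q p"
    and q\<sigma>: "Re (dual_apply (canonical 1 - q) \<sigma>) \<le> 0"
  proof (cases "\<sigma> = 0")
    case True
    have "p - 0 = bidual_adj p \<odot> p" using p(1) by (simp add: bidual_projection_def)
    then have "bidual_le 0 p" unfolding bidual_le_def by blast
    then show thesis using that[OF peak_projection_zero[OF A]] True by simp
  next
    case False
    define \<tau> where "\<tau> = of_real (1 / norm \<sigma>) *\<^sub>C \<sigma>"
    have "positive_functional \<tau>"
      unfolding \<tau>_def using \<sigma>_pos by (intro positive_functional_scale) simp_all
    moreover have "norm \<tau> = 1" using False by (simp add: \<tau>_def norm_scaleC norm_divide)
    moreover have "cut p \<sigma> = \<sigma>"
      using p by (simp add: \<sigma>_def cut_cut bidual_projection_def)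
    ultimately have "state \<tau>" "singular z\<^sub>n \<tau>"
      by (simp_all add: state_def positive_functional_def singular_def singular_part_def
          \<tau>_def cut_scaleC flip: p_def)
    then obtain q where q: "peak_projection A q" "dual_apply q \<tau> = 1" "bidual_le q p"
      using assms(3) unfolding ueda_algebra_def p_def by blast
    have "dual_apply q \<sigma> = of_real (norm \<sigma>)"
      using q(2) False by (simp add: \<tau>_def dual_apply_scaleC field_simps del: dual_apply_scaleC_fun)
    \<comment> \<open>The inequality suffices in place of \<sigma>(1) = norm \<sigma>: it bounds (1
      - q)(\<sigma>) above by 0, and positivity gives the other side.\<close>
    moreover have "Re (dual_apply \<sigma> 1) \<le> norm \<sigma>"
      using norm_dual_apply[of \<sigma> 1] complex_Re_le_cmod[of "dual_apply \<sigma> 1"] by simp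
    ultimately have "Re (dual_apply (canonical 1 - q) \<sigma>) \<le> 0" by simp
    with q that show thesis by blast
  qed
  have qp: "bidual_projection q" using q(1) by (simp add: peak_projection_def)
  note nn = pos_cut[THEN projection_apply_nonneg(2)[OF _ bidual_projection_compl[OF qp]]]
  note rl = pos_cut[THEN projection_apply_nonneg(1)[OF _ bidual_projection_compl[OF qp]]]
  have sum: "Re (dual_apply (canonical 1 - q) (cut p \<psi>\<^sub>1)) + Re (dual_apply (canonical 1 - q) (cut p \<psi>\<^sub>2))
      + Re (dual_apply (canonical 1 - q) (cut p \<psi>\<^sub>3)) + Re (dual_apply (canonical 1 - q) (cut p \<psi>\<^sub>4)) \<le> 0"
    using q\<sigma> unfolding \<sigma>_sum dual_apply_add by simp
  \<comment> \<open>Four nonnegative reals whose sum is at most 0.\<close>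
  have null: "dual_apply (canonical 1 - q) (cut p \<psi>\<^sub>1) = 0" "dual_apply (canonical 1 - q) (cut p \<psi>\<^sub>2) = 0"
      "dual_apply (canonical 1 - q) (cut p \<psi>\<^sub>3) = 0" "dual_apply (canonical 1 - q) (cut p \<psi>\<^sub>4) = 0"
    using sum nn rl unfolding complex_eq_iff complex_is_Real_iff by (simp_all only: zero_complex.sel) linarith+
  note cut_eq = positive_cut_by_dominated_projection[OF _ z qp q(2)[unfolded p_def], folded p_def]
  have key: "dual_apply (q \<odot> canonical x) \<phi> = dual_apply (cut p \<phi>) x" for x
    using cut_eq[OF pos(1) null(1)] cut_eq[OF pos(2) null(2)] cut_eq[OF pos(3) null(3)] cut_eq[OF pos(4) null(4)]
    unfolding \<phi> dual_apply_add dual_apply_diff dual_apply_scaleC cut_add cut_diff cut_scaleC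
    by (simp del: arens_apply)
  have sing: "dual_apply (cut p \<phi>) x = 0" if "x \<in> A" for x
    using peak_projection_annihilates[OF A q(1) assms(4) that] key by simp
  have "cut p \<phi> = \<phi> - cut z\<^sub>n \<phi>" by (simp add: p_def cut_diff_left cut_one)
  then have "dual_apply (cut z\<^sub>n \<phi>) x = dual_apply \<phi> x - dual_apply (cut p \<phi>) x" for x by simp
  then show ?thesis
    using sing assms(4) by (simp add: annihilator_def normal_part_def singular_part_def flip: p_def)
qed

end
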